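(* Let $\Delta\subset\mathbb{R}^n$ ($n\ge 2$) be a nondegenerate $n$-simplex with faces $F_0,\dots,F_n$ and normalized outward normals $\mathbf{k}_0,\dots,\mathbf{k}_n$. Let $X$ be the $\left(\frac12 n(n+1)-1\right)$-dimensional affine space of all tuples $[p_0,p_1,\dots,p_n]$ such that each $p_i$ lies in the $(n-1)$-dimensional hyperplane containing $F_i$ and the matrix $A=\sum_{i=0}^n\mathbf{k}_ip_i^T$ is symmetric. Let $\mathcal{G}=[g_0,\dots,g_n]\in X$ be the tuple of centroids of the faces, and let $N$ be an open neighbourhood of $\mathcal{G}$ in $X$ all of whose members immobilize $\Delta$. Then the contact set $\mathcal{G}$ is optimal in the following sense: any (non-zero) displacement from $\mathcal{G}$ within the neighbourhood $N$ causes the smallest sum of a pair of eigenvalues of $A$ to decrease from $2\,\mathrm{vol}(\Delta)$, its value at $\mathcal{G}$; and if such a displacement from $\mathcal{G}$ (in $X$, with each displaced point $p_i$ still in the interior of its face $F_i$) is large enough to cause this smallest sum to vanish, then immobilization is lost, i.e. the displaced contact set does not immobilize $\Delta$.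
   Context: $\Delta$ has vertices $v_0,\dots,v_n$, ordered so that $\mathrm{vol}(\Delta)=\frac{1}{n!}\det[v_1-v_0,\dots,v_n-v_0]>0$. $F_i$ is the face of $\Delta$ opposite $v_i$ (with vertices $v_j$, $j\ne i$), and $g_i=\frac1n\sum_{j\neq i}v_j$ is its centroid. $\mathbf{k}_i$ is the outward pointing normal to $F_i$ with $|\mathbf{k}_i|=\mathrm{vol}(F_i)$ (the $(n-1)$-dimensional volume); then $\sum_{i=0}^n\mathbf{k}_i=\mathbf{0}$. Vectors are columns, so $A$ is an $n\times n$ matrix. Eigenvalues are listed with multiplicity; a pair of eigenvalues means two entries with different indices in this list. $\mathbb{E}_n$ is the group of (orientation preserving) rigid motions $x\mapsto Rx+\underline{a}$ of $\mathbb{R}^n$, $R\in SO(n)$, with its usual topology. A contact set of points $p_i\in F_i$ ($i=0,\dots,n$) immobilizes $\Delta$ if there is a neighbourhood $U$ of the identity in $\mathbb{E}_n$ such that for every $g\in U$, $g\neq I$, at least one $g(p_i)$ lies in the interior of $\Delta$.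
   Formalization: The strict decrease of the smallest eigenvalue pair sum is stated for n ≥ 3 only; for n = 2 it is false, since the only pair sums to tr A, which is constantly 2 vol(Δ) on X, and equality is stated there instead. *)

theory Defs
  imports "HOL-Analysis.Analysis" "HOL-Computational_Algebra.Polynomial"
begin

text \<open>
  Space is \<open>real^'n\<close> with \<open>n = CARD('n)\<close>.  The \<open>n + 1\<close> indices \<open>0, \<dots>, n\<close> are the elements of
  \<open>'n option\<close>, where \<open>None\<close> plays the role of \<open>0\<close>; the labels of the remaining vertices then match
  the columns of \<open>[v\<^sub>1 - v\<^sub>0, \<dots>, v\<^sub>n - v\<^sub>0]\<close>.  Tuples \<open>[p\<^sub>0, \<dots>, p\<^sub>n]\<close> are elements of
  \<open>real^'n^('n option)\<close> and carry its Euclidean topology.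
\<close>

definition edge_matrix :: "('n option \<Rightarrow> real^'n) \<Rightarrow> real^'n^'n" where
  "edge_matrix v = (\<chi> i j. (v (Some j) - v None) $ i)"

definition simplex_of :: "('n::finite option \<Rightarrow> real^'n) \<Rightarrow> (real^'n) set" where
  "simplex_of v = convex hull (range v)"

definition face :: "('n::finite option \<Rightarrow> real^'n) \<Rightarrow> 'n option \<Rightarrow> (real^'n) set" where
  "face v i = convex hull (v ` (UNIV - {i}))"

definition centroids :: "('n::finite option \<Rightarrow> real^'n) \<Rightarrow> real^'n^('n option)" where
  "centroids v = (\<chi> i. (1 / real CARD('n)) *\<^sub>R (\<Sum>j\<in>UNIV - {i}. v j))"

text \<open>
  The \<open>(n - 1)\<close>-dimensional volume of a subset of a hyperplane in \<open>n\<close>-space, as the Lebesgue measure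
  of the right cylinder of height \<open>1\<close> over it.  For a set spanning a hyperplane the direction \<open>u\<close>
  is determined up to sign, which does not affect the value.
\<close>

definition hyperplane_volume :: "'a::euclidean_space set \<Rightarrow> real" where
  "hyperplane_volume S =
     (let u = (SOME u. norm u = 1 \<and> (\<forall>x\<in>S. \<forall>y\<in>S. u \<bullet> (x - y) = 0))
      in measure lebesgue {x + t *\<^sub>R u | x t. x \<in> S \<and> t \<in> {0..1}})"

definition normalized_outward_normal ::
    "('n::finite option \<Rightarrow> real^'n) \<Rightarrow> 'n option \<Rightarrow> real^'n \<Rightarrow> bool" where
  "normalized_outward_normal v i k \<longleftrightarrow>
     (\<forall>x\<in>face v i. \<forall>y\<in>face v i. k \<bullet> (x - y) = 0) \<and>
     (\<forall>x\<in>face v i. k \<bullet> (v i - x) < 0) \<and>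
     norm k = hyperplane_volume (face v i)"

text \<open>The matrix \<open>A = \<Sum>\<^sub>i k\<^sub>i p\<^sub>i\<^sup>T\<close>.\<close>

definition contact_matrix ::
    "('n option \<Rightarrow> real^'n) \<Rightarrow> real^'n^('n::finite option) \<Rightarrow> real^'n^'n" where
  "contact_matrix k P = (\<chi> a b. \<Sum>i\<in>UNIV. k i $ a * P $ i $ b)"

definition symmetric_tuples ::
    "('n::finite option \<Rightarrow> real^'n) \<Rightarrow> ('n option \<Rightarrow> real^'n) \<Rightarrow> (real^'n^('n option)) set" where
  "symmetric_tuples v k =
     {P. (\<forall>i. P $ i \<in> affine hull (face v i)) \<and>
         transpose (contact_matrix k P) = contact_matrix k P}"

definition characteristic_poly :: "real^'n^'n \<Rightarrow> real poly" where
  "characteristic_poly A = det (\<chi> i j. (if i = j then [:0, 1:] else 0) - [:A $ i $ j:])"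

text \<open>
  Real eigenvalues with algebraic multiplicity; these are all the eigenvalues when \<open>A\<close> is symmetric,
  which is the only case of interest.
\<close>

definition eigenvalue_mset :: "real^'n^'n \<Rightarrow> real multiset" where
  "eigenvalue_mset A = proots (characteristic_poly A)"

definition min_eigenvalue_pair_sum :: "real^'n^'n \<Rightarrow> real" where
  "min_eigenvalue_pair_sum A = Min {a + b | a b. {#a, b#} \<subseteq># eigenvalue_mset A}"

text \<open>The rigid motion \<open>x \<mapsto> R x + a\<close> is represented by \<open>(R, a)\<close>; the identity is \<open>(mat 1, 0)\<close>.\<close>

definition rigid_motions :: "((real^'n^'n) \<times> (real^'n)) set" where
  "rigid_motions = {(R, a). rotation_matrix R}"

definition apply_motion :: "(real^'n^'n) \<times> (real^'n) \<Rightarrow> real^'n \<Rightarrow> real^'n" where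
  "apply_motion g x = fst g *v x + snd g"

definition immobilizes ::
    "('n::finite option \<Rightarrow> real^'n) \<Rightarrow> real^'n^('n option) \<Rightarrow> bool" where
  "immobilizes v P \<longleftrightarrow>
     (\<forall>i. P $ i \<in> face v i) \<and>
     (\<exists>U. openin (top_of_set rigid_motions) U \<and> (mat 1, 0) \<in> U \<and>
        (\<forall>g\<in>U. g \<noteq> (mat 1, 0) \<longrightarrow> (\<exists>i. apply_motion g (P $ i) \<in> interior (simplex_of v))))"

end

theory Submission
  imports Defs
begin

text \<open>
  Write \<open>n = CARD('n)\<close> and \<open>V = n * vol\<close>.  The normalization of the normals says exactly that
  \<open>k\<^sub>i \<bullet> (v\<^sub>i - v\<^sub>j) = - V\<close> for \<open>j \<noteq> i\<close>, that is, \<open>- k\<^sub>i / V\<close> is the gradient of the \<open>i\<close>-th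
  barycentric coordinate (\<open>normal_inner_edge\<close>; this is the formula
  "volume of a cone = height * base / n").  All facts about normals are consequences of this:
  \<open>\<Sum>k\<^sub>i = 0\<close> and \<open>\<Sum>k\<^sub>i v\<^sub>i\<^sup>T = - V I\<close>, whence \<open>A = vol I\<close> at the centroids.

  The trace of \<open>A\<close> is \<open>\<Sum>k\<^sub>i \<bullet> p\<^sub>i\<close>, which depends only on the hyperplanes of the faces and thus equals
  \<open>n * vol\<close> on all of \<open>X\<close>.  Moreover, the tuple \<open>[p\<^sub>0, \<dots>, p\<^sub>n]\<close> is determined by \<open>A\<close>, and
  every symmetric matrix with this trace occurs (\<open>contact_matrix_kernel\<close>, \<open>contact_matrix_onto\<close>).
  So \<open>X\<close> is an affine copy of the symmetric matrices of trace \<open>n * vol\<close>, which gives its dimension,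
  and a tuple other than that of the centroids has \<open>A \<noteq> vol I\<close>.  The sum of all eigenvalues
  being fixed, the smallest sum of a pair is largest when all pairs have the same sum; for \<open>n \<ge> 3\<close>
  this forces all eigenvalues to be equal (\<open>min_eigenvalue_pair_sum_less\<close>), and for \<open>n = 2\<close>
  the only pair has the trace as its sum.

  For the loss of immobilization, let \<open>R\<close> be the rotation by \<open>\<theta>\<close> in the plane of two
  orthonormal eigenvectors with eigenvalues \<open>a\<close> and \<open>b\<close>.  The numbers \<open>k\<^sub>i \<bullet> (R p\<^sub>i - p\<^sub>i)\<close>, which say how
  far the contact points leave the hyperplanes of their faces, add up to
  \<open>(cos \<theta> - 1) * (a + b)\<close> (\<open>sum_normals_plane_rotation\<close>).  If \<open>a + b = 0\<close>, then a
  translation can cancel all of them at once, since the only linear relation between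
  the normals is \<open>\<Sum>k\<^sub>i = 0\<close>.  This gives a curve of rigid motions through the identity along
  which every contact point stays in the hyperplane of its face.
\<close>

section \<open>Volumes of simplices and prisms\<close>

text \<open>The lemma \<open>measure_shear_interval\<close> asks for a nonnegative \<open>a $ n\<close>; translating the corner \<open>a\<close> to the
  origin reduces to that case.\<close>

lemma measure_shear_box:
  fixes a b :: "real^'n"
  assumes "m \<noteq> n"
  shows "measure lebesgue ((\<lambda>x. \<chi> i. if i = m then x $ m + x $ n else x $ i) ` cbox a b)
       = measure lebesgue (cbox a b)"
proof (cases "cbox a b = {}")
  case True
  then show ?thesis by simp
next
  case False
  let ?f = "\<lambda>x::real^'n. \<chi> i. if i = m then x $ m + x $ n else x $ i"
  have cb: "cbox a b = (+) a ` cbox 0 (b - a)"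
    using cbox_translation[of a 0 "b - a"] by simp
  have ne: "cbox 0 (b - a) \<noteq> {}"
    using False cb by auto
  have "?f ` cbox a b = (+) (?f a) ` ?f ` cbox 0 (b - a)"
    unfolding cb image_image by (intro image_cong refl) (auto simp: vec_eq_iff)
  then have "measure lebesgue (?f ` cbox a b) = measure lebesgue (?f ` cbox 0 (b - a))"
    by (simp only: measure_translation)
  also have "\<dots> = measure lebesgue (cbox 0 (b - a))"
    by (rule measure_shear_interval[OF assms ne]) simp
  also have "\<dots> = measure lebesgue (cbox a b)"
    unfolding cb by (rule measure_translation[symmetric])
  finally show ?thesis .
qed

lemma measure_swap_box:
  fixes a b :: "real^'n"
  shows "measure lebesgue ((\<lambda>x. \<chi> i. x $ Transposition.transpose m n i) ` cbox a b)
       = measure lebesgue (cbox a b)"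
proof (cases "cbox a b = {}")
  case True
  then show ?thesis by simp
next
  case False
  let ?f = "\<lambda>x::real^'n. \<chi> i. x $ Transposition.transpose m n i"
  have ff: "?f (?f x) = x" for x
    by (simp add: vec_eq_iff)
  have mono: "?f x \<in> cbox (?f c) (?f d)" if "x \<in> cbox c d" for x c d
    using that by (simp add: mem_box_cart)
  have "?f ` cbox a b = cbox (?f a) (?f b)"
  proof
    show "?f ` cbox a b \<subseteq> cbox (?f a) (?f b)"
      using mono by blast
    show "cbox (?f a) (?f b) \<subseteq> ?f ` cbox a b"
    proof
      fix y assume "y \<in> cbox (?f a) (?f b)"
      then have "?f y \<in> cbox (?f (?f a)) (?f (?f b))"
        by (rule mono)
      then have "?f y \<in> cbox a b"
        unfolding ff .
      then show "y \<in> ?f ` cbox a b"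
        using ff[of y] by (metis image_eqI)
    qed
  qed
  moreover have "cbox (?f a) (?f b) \<noteq> {}"
    using False calculation by blast
  moreover have "(\<Prod>i\<in>UNIV. (b - a) $ Transposition.transpose m n i) = (\<Prod>i\<in>UNIV. (b - a) $ i)"
    using prod.permute[OF permutes_swap_id[of m UNIV n], of "\<lambda>i. (b - a) $ i"] by (simp add: o_def)
  ultimately show ?thesis
    using False by (simp add: content_cbox_cart)
qed

text \<open>Both sides are multiplicative in \<open>f\<close>, so elementary maps suffice.  No order on the index type is
  involved: the determinant of a shear comes from a row operation.\<close>

lemma measure_linear_image_real_vec:
  fixes f :: "real^'n \<Rightarrow> real^'n"
  assumes "linear f" "S \<in> lmeasurable"
  shows "f ` S \<in> lmeasurable \<and> measure lebesgue (f ` S) = \<bar>det (matrix f)\<bar> * measure lebesgue S"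
proof -
  let ?P = "\<lambda>f::real^'n \<Rightarrow> real^'n. linear f \<and> (\<forall>S\<in>lmeasurable. f ` S \<in> lmeasurable \<and>
              measure lebesgue (f ` S) = \<bar>det (matrix f)\<bar> * measure lebesgue S)"
  have "?P f"
  proof (rule induct_linear_elementary[OF \<open>linear f\<close>])
    fix f g :: "real^'n \<Rightarrow> real^'n"
    assume lin: "linear f" "linear g" and f: "?P f" and g: "?P g"
    show "?P (f \<circ> g)"
    proof (intro conjI ballI)
      show "linear (f \<circ> g)" using lin by (rule linear_compose[rotated])
      fix S :: "(real^'n) set" assume S: "S \<in> lmeasurable"
      from g S have gS: "g ` S \<in> lmeasurable" by blast
      show "(f \<circ> g) ` S \<in> lmeasurable"
        using f gS by (metis image_comp)
      have "measure lebesgue ((f \<circ> g) ` S) = \<bar>det (matrix f)\<bar> * measure lebesgue (g ` S)"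
        using f gS by (metis image_comp)
      also have "\<dots> = \<bar>det (matrix (f \<circ> g))\<bar> * measure lebesgue S"
        using g S by (simp add: matrix_compose[OF lin(2,1)] det_mul abs_mult)
      finally show "measure lebesgue ((f \<circ> g) ` S) = \<bar>det (matrix (f \<circ> g))\<bar> * measure lebesgue S" .
    qed
  next
    fix f :: "real^'n \<Rightarrow> real^'n" and i
    assume f: "linear f" "\<And>x. f x $ i = 0"
    then have ninj: "\<not> inj f"
      by (metis linear_injective_imp_surjective one_neq_zero surjE vec_component)
    then have "negligible (f ` S)" for S
      using negligible_linear_singular_image[OF f(1)] by blast
    moreover have "det (matrix f) = 0"
      using ninj det_nz_iff_inj[OF f(1)] by blast
    ultimately show "?P f"
      by (simp add: f negligible_iff_measure)
  next
    fix c :: "'n \<Rightarrow> real"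
    show "?P (\<lambda>x. \<chi> i. c i * x $ i)"
      by (auto intro!: linearI simp: measurable_stretch measure_stretch axis_def matrix_def
          det_diagonal vec_eq_iff algebra_simps)
  next
    fix m n :: 'n assume "m \<noteq> n"
    let ?f = "\<lambda>x::real^'n. \<chi> i. x $ Transposition.transpose m n i"
    have lin: "linear ?f"
      by (rule linearI) (simp_all add: vec_eq_iff)
    have "matrix ?f = (\<chi> i. mat 1 $ Transposition.transpose m n i)"
      by (auto simp: matrix_def axis_def mat_def vec_eq_iff)
    then have det: "\<bar>det (matrix ?f)\<bar> = 1"
      by (simp add: det_permute_rows permutes_swap_id sign_swap_id abs_mult)
    have img: "?f ` S \<in> lmeasurable \<and> 1 * measure lebesgue S = measure lebesgue (?f ` S)"
      if "S \<in> lmeasurable" for S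
      by (rule measure_linear_sufficient[OF lin that]) (simp only: measure_swap_box mult_1)
    show "?P ?f"
    proof (intro conjI ballI)
      show "linear ?f" by (rule lin)
      fix S :: "(real^'n) set" assume "S \<in> lmeasurable"
      note im = img[OF this]
      show "?f ` S \<in> lmeasurable" using im by (rule conjunct1)
      show "measure lebesgue (?f ` S) = \<bar>det (matrix ?f)\<bar> * measure lebesgue S"
        unfolding det using im by (rule conjunct2[THEN sym])
    qed
  next
    fix m n :: 'n assume mn: "m \<noteq> n"
    let ?f = "\<lambda>x::real^'n. \<chi> i. if i = m then x $ m + x $ n else x $ i"
    have lin: "linear ?f"
      by (rule linearI) (auto simp: vec_eq_iff algebra_simps)
    have "matrix ?f = (\<chi> k. if k = m then row m (mat 1) + 1 *s row n (mat 1) else row k (mat 1))"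
      by (auto simp: matrix_def axis_def mat_def row_def vec_eq_iff)
    then have "det (matrix ?f) = 1"
      by (simp only: det_row_operation[OF mn] det_I)
    then have det: "\<bar>det (matrix ?f)\<bar> = 1"
      by (simp only: abs_one)
    have img: "?f ` S \<in> lmeasurable \<and> 1 * measure lebesgue S = measure lebesgue (?f ` S)"
      if "S \<in> lmeasurable" for S
      by (rule measure_linear_sufficient[OF lin that]) (simp only: measure_shear_box[OF mn] mult_1)
    show "?P ?f"
    proof (intro conjI ballI)
      show "linear ?f" by (rule lin)
      fix S :: "(real^'n) set" assume "S \<in> lmeasurable"
      note im = img[OF this]
      show "?f ` S \<in> lmeasurable" using im by (rule conjunct1)
      show "measure lebesgue (?f ` S) = \<bar>det (matrix ?f)\<bar> * measure lebesgue S"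
        unfolding det using im by (rule conjunct2[THEN sym])
    qed
  qed
  then show ?thesis using assms(2) by blast
qed

lemma measure_affine_image:
  fixes a :: "'n \<Rightarrow> real^'n"
  assumes "S \<in> lmeasurable"
  shows "measure lebesgue ((\<lambda>x. p + (\<Sum>i\<in>UNIV. x $ i *\<^sub>R a i)) ` S)
       = \<bar>det (\<chi> i. a i)\<bar> * measure lebesgue S"
proof -
  let ?f = "\<lambda>x::real^'n. \<Sum>i\<in>UNIV. x $ i *\<^sub>R a i"
  have lin: "linear ?f"
    by (rule linearI) (simp_all add: scaleR_left_distrib sum.distrib scaleR_sum_right)
  have "(\<Sum>k\<in>UNIV. axis j 1 $ k * a k $ i) = a j $ i" for i j
    by (simp add: axis_def if_distrib[of "\<lambda>x. x * _"] cong: if_cong)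
  then have "matrix ?f = transpose (\<chi> i. a i)"
    by (simp add: matrix_def transpose_def vec_eq_iff)
  then have det: "det (matrix ?f) = det (\<chi> i. a i)"
    by simp
  have "(\<lambda>x. p + ?f x) ` S = (+) p ` ?f ` S"
    by (simp add: image_image)
  then show ?thesis
    using measure_linear_image_real_vec[OF lin assms] det by (simp add: measure_translation)
qed

lemma measure_simplex:
  fixes a :: "'n \<Rightarrow> real^'n"
  shows "measure lebesgue (convex hull (insert p (range (\<lambda>i. p + a i))))
       = \<bar>det (\<chi> i. a i)\<bar> / fact CARD('n)"
proof -
  let ?S = "convex hull (insert 0 Basis :: (real^'n) set)"
  let ?f = "\<lambda>x::real^'n. \<Sum>i\<in>UNIV. x $ i *\<^sub>R a i"
  have lin: "linear ?f"
    by (rule linearI) (simp_all add: scaleR_left_distrib sum.distrib scaleR_sum_right)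
  have ax: "?f (axis j 1) = a j" for j
    by (simp add: axis_def if_distrib[of "\<lambda>x. x *\<^sub>R _"] cong: if_cong)
  have comp: "compact ?S"
    by (intro finite_imp_compact_convex_hull) auto
  have "(\<lambda>x. p + ?f x) ` ?S = (+) p ` (?f ` ?S)"
    by (simp add: image_image)
  also have "?f ` ?S = convex hull (?f ` insert 0 Basis)"
    by (rule convex_hull_linear_image[OF lin])
  also have "?f ` insert 0 Basis = insert 0 (range a)"
    using ax by (auto simp: Basis_vec_def image_iff)
  also have "(+) p ` (convex hull insert 0 (range a)) = convex hull ((+) p ` insert 0 (range a))"
    by (rule convex_hull_translation[symmetric])
  also have "(+) p ` insert 0 (range a) = insert p (range (\<lambda>i. p + a i))"
    by auto
  finally have "measure lebesgue (convex hull (insert p (range (\<lambda>i. p + a i))))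
       = \<bar>det (\<chi> i. a i)\<bar> * measure lebesgue ?S"
    using measure_affine_image[OF lmeasurable_compact[OF comp], of p a] by simp
  also have "measure lebesgue ?S = measure lborel ?S"
    using comp by (intro measure_completion) (auto dest: compact_imp_closed)
  finally show ?thesis
    by (simp add: content_std_simplex)
qed

text \<open>Integrating out the coordinate \<open>b\<close> leaves the standard simplex in the remaining
  coordinates.\<close>

lemma emeasure_PiM_prism:
  assumes "finite A" "b \<notin> A"
  shows "emeasure (Pi\<^sub>M (insert b A) (\<lambda>_. lborel :: real measure))
     ({x. (\<forall>i\<in>insert b A. 0 \<le> x i) \<and> x b \<le> 1 \<and> sum x A \<le> 1} \<inter> space (Pi\<^sub>M (insert b A) (\<lambda>_. lborel)))
     = ennreal (1 / fact (card A))"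
proof -
  let ?M = "\<lambda>A. (Pi\<^sub>M A (\<lambda>_. lborel :: real measure))"
  let ?P = "{x. (\<forall>i\<in>insert b A. 0 \<le> x i) \<and> x b \<le> 1 \<and> sum x A \<le> (1::real)}"
  let ?S = "{x. (\<forall>i\<in>A. 0 \<le> x i) \<and> sum x A \<le> (1::real)}"
  interpret product_sigma_finite "\<lambda>_. lborel :: real measure"
    by standard
  have "?S \<inter> space (?M A) = Pi\<^sub>E A (\<lambda>_. {0..}) \<inter> (\<lambda>x. sum x A) -` {..1} \<inter> space (?M A)"
    by (auto simp: space_PiM)
  also have "\<dots> \<in> sets (?M A)"
    using \<open>finite A\<close> by measurable
  finally have S: "?S \<inter> space (?M A) \<in> sets (?M A)" .
  have "?P \<inter> space (?M (insert b A)) = Pi\<^sub>E (insert b A) (\<lambda>_. {0..}) \<inter> ((\<lambda>x. x b) -` {..1} \<inter> space (?M (insert b A)))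
     \<inter> ((\<lambda>x. sum x A) -` {..1} \<inter> space (?M (insert b A)))"
    by (auto simp: space_PiM)
  also have "\<dots> \<in> sets (?M (insert b A))"
  proof (rule sets.Int[OF sets.Int])
    show "Pi\<^sub>E (insert b A) (\<lambda>_. {0..}) \<in> sets (?M (insert b A))"
      using \<open>finite A\<close> by (intro sets_PiM_I_finite) auto
    have "(\<lambda>x. x b) \<in> borel_measurable (?M (insert b A))"
      using measurable_component_singleton[of b "insert b A" "\<lambda>_. lborel"] by simp
    then show "(\<lambda>x. x b) -` {..1} \<inter> space (?M (insert b A)) \<in> sets (?M (insert b A))"
      by (rule measurable_sets) simp
    have "(\<lambda>x. x i) \<in> borel_measurable (?M (insert b A))" if "i \<in> A" for i
      using that measurable_component_singleton[of i "insert b A" "\<lambda>_. lborel"] by simp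
    then have "(\<lambda>x. sum x A) \<in> borel_measurable (?M (insert b A))"
      by (intro borel_measurable_sum) auto
    then show "(\<lambda>x. sum x A) -` {..1} \<inter> space (?M (insert b A)) \<in> sets (?M (insert b A))"
      by (rule measurable_sets) simp
  qed
  finally have P: "?P \<inter> space (?M (insert b A)) \<in> sets (?M (insert b A))" .
  have "emeasure (?M (insert b A)) (?P \<inter> space (?M (insert b A)))
      = nn_integral (?M (insert b A)) (\<lambda>x. indicator (?P \<inter> space (?M (insert b A))) x)"
    using P by (subst nn_integral_indicator) auto
  also have "\<dots> = (\<integral>\<^sup>+ y. \<integral>\<^sup>+ x. indicator (?P \<inter> space (?M (insert b A))) (x(b := y)) \<partial>?M A \<partial>lborel)"
    using assms P by (intro product_nn_integral_insert_rev) auto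
  also have "\<dots> = (\<integral>\<^sup>+ y. \<integral>\<^sup>+ x. indicator {0..1::real} y * indicator (?S \<inter> space (?M A)) x \<partial>?M A \<partial>lborel)"
  proof (intro nn_integral_cong)
    fix y :: real and x assume x: "x \<in> space (?M A)"
    have "(\<Sum>i\<in>A. (x(b := y)) i) = sum x A"
      using assms by (intro sum.cong) auto
    moreover have "(\<forall>i\<in>insert b A. 0 \<le> (x(b := y)) i) \<longleftrightarrow> 0 \<le> y \<and> (\<forall>i\<in>A. 0 \<le> x i)"
      using assms by auto
    moreover have "x(b := y) \<in> space (?M (insert b A))"
      using x by (auto simp: space_PiM PiE_def extensional_def)
    ultimately have "x(b := y) \<in> ?P \<inter> space (?M (insert b A)) \<longleftrightarrow> y \<in> {0..1} \<and> x \<in> ?S \<inter> space (?M A)"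
      using x by (simp only: Int_iff mem_Collect_eq fun_upd_same atLeastAtMost_iff) blast
    then show "indicator (?P \<inter> space (?M (insert b A))) (x(b := y))
        = (indicator {0..1} y * indicator (?S \<inter> space (?M A)) x :: ennreal)"
      by (simp only: indicator_def) simp
  qed
  also have "\<dots> = (\<integral>\<^sup>+ y. indicator {0..1::real} y * emeasure (?M A) (?S \<inter> space (?M A)) \<partial>lborel)"
    using S by (simp add: nn_integral_cmult)
  also have "\<dots> = emeasure (?M A) (?S \<inter> space (?M A))"
    by (subst nn_integral_multc) auto
  also have "\<dots> = ennreal (1 / fact (card A))"
    using emeasure_std_simplex_aux[OF \<open>finite A\<close>, of 1] by simp
  finally show ?thesis .
qed

lemma measure_std_prism:
  fixes b :: "'a::euclidean_space"
  assumes "b \<in> Basis"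
  shows "measure lebesgue {y + t *\<^sub>R b | y t. y \<in> convex hull (insert 0 (Basis - {b})) \<and> t \<in> {0..1}}
       = 1 / fact (DIM('a) - 1)" (is "measure lebesgue ?Q = _")
    and "{y + t *\<^sub>R b | y t. y \<in> convex hull (insert 0 (Basis - {b})) \<and> t \<in> {0..1}} \<in> lmeasurable"
proof -
  let ?P = "{x::'a. (\<forall>i\<in>Basis. 0 \<le> x \<bullet> i) \<and> x \<bullet> b \<le> 1 \<and> (\<Sum>i\<in>Basis - {b}. x \<bullet> i) \<le> 1}"
  let ?C = "convex hull (insert 0 (Basis - {b}))"
  have C: "?C = {x. (\<forall>i\<in>Basis. 0 \<le> x \<bullet> i) \<and> (\<Sum>i\<in>Basis - {b}. x \<bullet> i) \<le> 1 \<and> x \<bullet> b = 0}"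
    using assms by (subst substd_simplex) auto
  have QP: "?Q = ?P"
  proof (intro equalityI subsetI)
    fix x assume "x \<in> ?Q"
    then obtain y t where x: "x = y + t *\<^sub>R b" and y: "y \<in> ?C" and t: "0 \<le> t" "t \<le> 1"
      by auto
    have xi: "x \<bullet> i = y \<bullet> i + (if i = b then t else 0)" if "i \<in> Basis" for i
      using assms that by (simp add: x inner_add_left inner_Basis)
    have "(\<Sum>i\<in>Basis - {b}. x \<bullet> i) = (\<Sum>i\<in>Basis - {b}. y \<bullet> i)"
      using xi by (intro sum.cong) auto
    then show "x \<in> ?P"
      using y t assms by (auto simp: C xi)
  next
    fix x assume x: "x \<in> ?P"
    let ?y = "x - (x \<bullet> b) *\<^sub>R b"
    have yi: "?y \<bullet> i = (if i = b then 0 else x \<bullet> i)" if "i \<in> Basis" for i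
      using assms that by (simp add: inner_diff_left inner_Basis)
    have "(\<Sum>i\<in>Basis - {b}. ?y \<bullet> i) = (\<Sum>i\<in>Basis - {b}. x \<bullet> i)"
      using yi by (intro sum.cong) auto
    then have "?y \<in> ?C"
      using x assms unfolding C by (auto simp: yi)
    moreover have "x = ?y + (x \<bullet> b) *\<^sub>R b" by simp
    ultimately show "x \<in> ?Q"
      using x assms by (auto intro!: exI[of _ ?y] exI[of _ "x \<bullet> b"])
  qed
  have "?P = (\<Inter>i\<in>Basis. {x. 0 \<le> x \<bullet> i}) \<inter> {x. x \<bullet> b \<le> 1} \<inter> {x. (\<Sum>i\<in>Basis - {b}. x \<bullet> i) \<le> 1}"
    by auto
  also have "closed \<dots>"
    by (intro closed_Int closed_INT ballI closed_Collect_le continuous_intros)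
  finally have "closed ?P" .
  have "emeasure lborel ?P =
      emeasure (distr (Pi\<^sub>M Basis (\<lambda>b. lborel)) borel (\<lambda>f. \<Sum>b\<in>Basis. f b *\<^sub>R b)) ?P"
    by (subst lborel_eq) simp
  also have "\<dots> = emeasure (Pi\<^sub>M Basis (\<lambda>b. lborel)) ((\<lambda>f. \<Sum>b\<in>Basis. f b *\<^sub>R b) -` ?P \<inter> space (Pi\<^sub>M Basis (\<lambda>b. lborel)))"
    using \<open>closed ?P\<close> by (intro emeasure_distr) (auto intro: borel_closed)
  also have "(\<lambda>f. \<Sum>b\<in>Basis. f b *\<^sub>R b) -` ?P
      = {y. (\<forall>i\<in>Basis. 0 \<le> y i) \<and> y b \<le> 1 \<and> sum y (Basis - {b}) \<le> 1}"
    using assms by (auto simp: inner_sum_left inner_Basis if_distrib sum.delta cong: if_cong)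
  also have "emeasure (Pi\<^sub>M Basis (\<lambda>b. lborel)) (\<dots> \<inter> space (Pi\<^sub>M Basis (\<lambda>b. lborel)))
      = ennreal (1 / fact (card (Basis - {b} :: 'a set)))"
    using emeasure_PiM_prism[of "Basis - {b}" b] assms by (simp add: insert_absorb)
  also have "card (Basis - {b} :: 'a set) = DIM('a) - 1"
    using assms by simp
  finally have em: "emeasure lborel ?P = ennreal (1 / fact (DIM('a) - 1))" .
  have Pb: "?P \<in> sets lborel" using \<open>closed ?P\<close> by auto
  show "?Q \<in> lmeasurable"
    unfolding QP using Pb em by (intro fmeasurableI) auto
  show "measure lebesgue ?Q = 1 / fact (DIM('a) - 1)"
    unfolding QP using Pb em by (simp add: measure_def)
qed

text \<open>The cylinder of \<open>hyperplane_volume\<close> over a face, with \<open>p\<close> a vertex of the face and \<open>s\<close> the label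
  that is replaced by the direction \<open>u\<close> of the cylinder.\<close>

lemma measure_prism:
  fixes a :: "'n \<Rightarrow> real^'n"
  shows "measure lebesgue {x + t *\<^sub>R u | x t.
           x \<in> convex hull (insert p ((\<lambda>i. p + a i) ` (UNIV - {s}))) \<and> t \<in> {0..1}}
       = \<bar>det (\<chi> i. if i = s then u else a i)\<bar> / fact (CARD('n) - 1)"
proof -
  define b where "b i = (if i = s then u else a i)" for i
  let ?b = "axis s 1 :: real^'n"
  let ?D = "Basis - {?b}"
  let ?Q = "{y + t *\<^sub>R ?b | y t. y \<in> convex hull (insert 0 ?D) \<and> t \<in> {0..1}}"
  let ?f = "\<lambda>x::real^'n. \<Sum>i\<in>UNIV. x $ i *\<^sub>R b i"
  have lin: "linear ?f"
    by (rule linearI) (simp_all add: scaleR_left_distrib sum.distrib scaleR_sum_right)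
  have ax: "?f (axis j 1) = b j" for j
    by (simp add: axis_def if_distrib[of "\<lambda>x. x *\<^sub>R _"] cong: if_cong)
  have bB: "?b \<in> Basis"
    by (auto simp: Basis_vec_def)
  have D: "?D = (\<lambda>i. axis i 1) ` (UNIV - {s})"
    by (auto simp: Basis_vec_def axis_eq_axis)
  have "(+) p ` ?f ` (convex hull (insert 0 ?D)) = (+) p ` (convex hull (?f ` insert 0 ?D))"
    by (simp only: convex_hull_linear_image[OF lin])
  also have "\<dots> = convex hull ((+) p ` ?f ` insert 0 ?D)"
    by (rule convex_hull_translation[symmetric])
  also have "?f ` insert 0 ?D = insert 0 (b ` (UNIV - {s}))"
    by (simp only: D image_insert image_image ax linear_0[OF lin])
  also have "b ` (UNIV - {s}) = a ` (UNIV - {s})"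
    by (auto simp: b_def)
  also have "(+) p ` insert 0 (a ` (UNIV - {s})) = insert p ((\<lambda>i. p + a i) ` (UNIV - {s}))"
    by auto
  finally have "convex hull (insert p ((\<lambda>i. p + a i) ` (UNIV - {s})))
      = (+) p ` ?f ` (convex hull (insert 0 ?D))" by (rule sym)
  moreover define F where "F = (\<lambda>x. p + ?f x)"
  ultimately have hull: "convex hull (insert p ((\<lambda>i. p + a i) ` (UNIV - {s})))
      = F ` (convex hull (insert 0 ?D))"
    by (simp only: image_image F_def)
  have bs: "b s = u" by (simp add: b_def)
  have step: "F (y + t *\<^sub>R ?b) = F y + t *\<^sub>R u" for y t
    unfolding F_def linear_add[OF lin] linear_scale[OF lin] ax bs by (simp only: add.assoc)
  have "{x + t *\<^sub>R u | x t. x \<in> F ` C \<and> t \<in> T} = F ` {y + t *\<^sub>R ?b | y t. y \<in> C \<and> t \<in> T}" for C T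
    using step by (auto simp: image_iff) metis+
  then have "measure lebesgue {x + t *\<^sub>R u | x t.
           x \<in> convex hull (insert p ((\<lambda>i. p + a i) ` (UNIV - {s}))) \<and> t \<in> {0..1}}
       = \<bar>det (\<chi> i. b i)\<bar> * measure lebesgue ?Q"
    unfolding hull F_def by (simp only: measure_affine_image measure_std_prism(2)[OF bB])
  also have "measure lebesgue ?Q = 1 / fact (CARD('n) - 1)"
    by (subst measure_std_prism(1)[OF bB]) simp
  finally show ?thesis
    by (simp add: b_def)
qed

lemma span_others_eq_orthogonal_hyperplane:
  fixes a :: "'n \<Rightarrow> real^'n"
  assumes det: "det (\<chi> i. a i) \<noteq> 0" and "u \<noteq> 0" and orth: "\<And>i. i \<noteq> s \<Longrightarrow> u \<bullet> a i = 0"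
  shows "span (a ` (UNIV - {s})) = {x. u \<bullet> x = 0}"
proof -
  let ?A = "(\<chi> i. a i) :: real^'n^'n"
  have row: "row i ?A = a i" for i
    by (simp add: row_def vec_eq_iff)
  have inj: "inj a"
    using det det_identical_rows[of _ _ ?A] unfolding row inj_def by blast
  have "rows ?A = range a"
    unfolding rows_def row by auto
  then have "independent (range a)"
    using det det_dependent_rows[of ?A] by (auto simp: dependent_vec_eq)
  then have ind: "independent (a ` (UNIV - {s}))"
    by (rule independent_mono) auto
  have "dim (span (a ` (UNIV - {s}))) = card (a ` (UNIV - {s}))"
    using ind by (simp add: dim_eq_card_independent)
  also have "\<dots> = CARD('n) - 1"
    using inj by (simp add: card_image inj_on_def card_Diff_singleton)
  also have "\<dots> = dim {x. u \<bullet> x = 0}"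
    using \<open>u \<noteq> 0\<close> by (simp add: dim_hyperplane)
  finally have dims: "dim {x. u \<bullet> x = 0} \<le> dim (span (a ` (UNIV - {s})))"
    by simp
  have "span (a ` (UNIV - {s})) \<subseteq> {x. u \<bullet> x = 0}"
    using orth by (intro span_minimal subspace_hyperplane) auto
  then show ?thesis
    using dims by (intro subspace_dim_equal subspace_span subspace_hyperplane) auto
qed

text \<open>Base times height: the vectors other than \<open>a s\<close> span the hyperplane orthogonal to \<open>u\<close>, so
  \<open>a s\<close> may be replaced by its component along \<open>u\<close>.\<close>

lemma det_eq_height_mult:
  fixes a :: "'n \<Rightarrow> real^'n"
  assumes det: "det (\<chi> i. a i) \<noteq> 0" and u: "norm u = 1" and orth: "\<And>i. i \<noteq> s \<Longrightarrow> u \<bullet> a i = 0"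
  shows "det (\<chi> i. a i) = (u \<bullet> a s) * det (\<chi> i. if i = s then u else a i)"
proof -
  define w where "w = a s - (u \<bullet> a s) *\<^sub>R u"
  have "u \<bullet> u = 1"
    using u by (simp add: norm_eq_1)
  then have "u \<bullet> w = 0"
    by (simp add: w_def inner_diff_right)
  moreover have "u \<noteq> 0"
    using u by auto
  ultimately have "w \<in> span (a ` (UNIV - {s}))"
    using span_others_eq_orthogonal_hyperplane[OF det _ orth] by auto
  moreover define Z where "Z = ((\<chi> i. if i = s then 0 else a i) :: real^'n^'n)"
  have row: "row i Z = (if i = s then 0 else a i)" for i
    by (simp add: row_def Z_def vec_eq_iff)
  have "a ` (UNIV - {s}) = {row j Z | j. j \<noteq> s}"
    unfolding row by auto
  ultimately have "w \<in> vec.span {row j Z | j. j \<noteq> s}"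
    by (simp add: span_vec_eq)
  from det_row_span[OF this] have "det (\<chi> i. if i = s then w else a i) = det Z"
    unfolding row by (simp cong: if_cong)
  also have "\<dots> = 0"
    by (rule det_zero_row(2)[of s]) (simp add: row)
  finally have w0: "det (\<chi> i. if i = s then w else a i) = 0" .
  have "(\<chi> i. a i) = (\<chi> i. if i = s then (u \<bullet> a s) *s u + w else a i)"
    by (auto simp: vec_eq_iff w_def)
  also have "det \<dots> = det (\<chi> i. if i = s then (u \<bullet> a s) *s u else a i) + det (\<chi> i. if i = s then w else a i)"
    by (rule det_row_add)
  also have "\<dots> = (u \<bullet> a s) * det (\<chi> i. if i = s then u else a i)"
    by (simp add: w0 det_row_mul)
  finally show ?thesis .
qed

text \<open>Any vertex \<open>j\<close> may serve as origin.  The volume of the simplex has to be compared with that of each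
  of its faces, and the face opposite \<open>None\<close> does not contain the vertex used in \<open>edge_matrix\<close>.\<close>

lemma simplex_of_eq:
  fixes v :: "'n::finite option \<Rightarrow> real^'n"
  assumes "bij_betw \<sigma> (UNIV :: 'n set) (UNIV - {j})"
  shows "simplex_of v = convex hull (insert (v j) (range (\<lambda>l. v j + (v (\<sigma> l) - v j))))"
proof -
  have "range \<sigma> = UNIV - {j}"
    using assms by (simp add: bij_betw_def)
  then have "range (\<lambda>l. v (\<sigma> l)) = v ` (UNIV - {j})"
    by (metis image_image)
  then have "insert (v j) (range (\<lambda>l. v (\<sigma> l))) = range v"
    by auto
  then show ?thesis
    by (simp add: simplex_of_def)
qed

lemma measure_simplex_of:
  fixes v :: "'n::finite option \<Rightarrow> real^'n"
  assumes "bij_betw \<sigma> (UNIV :: 'n set) (UNIV - {j})"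
  shows "measure lebesgue (simplex_of v) = \<bar>det (\<chi> l. v (\<sigma> l) - v j)\<bar> / fact CARD('n)"
  unfolding simplex_of_eq[OF assms] by (rule measure_simplex)

lemma measure_simplex_of_edge_matrix:
  fixes v :: "'n::finite option \<Rightarrow> real^'n"
  shows "measure lebesgue (simplex_of v) = \<bar>det (edge_matrix v)\<bar> / fact CARD('n)"
proof -
  have "bij_betw Some (UNIV :: 'n set) (UNIV - {None})"
    by (simp add: bij_betw_def UNIV_option_conv)
  moreover have "edge_matrix v = transpose (\<chi> l. v (Some l) - v None)"
    by (simp add: edge_matrix_def transpose_def vec_eq_iff)
  ultimately show ?thesis
    using measure_simplex_of[of Some None v] by simp
qed

text \<open>A normal of the face is a multiple of the unit vector \<open>u\<close> chosen in
  \<open>hyperplane_volume\<close>, because the edges of the face span the orthogonal complement of \<open>u\<close>.  Hence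
  \<open>\<bar>k \<bullet> (v i - v j)\<bar>\<close> is the height over the face times the volume of the face, and both volumes are determinants
  that differ by this height.\<close>

lemma normal_inner_edge:
  fixes v :: "'n::finite option \<Rightarrow> real^'n"
  assumes nd: "det (edge_matrix v) \<noteq> 0" and k: "normalized_outward_normal v i k" and "j \<noteq> i"
  shows "k \<bullet> (v i - v j) = - (real CARD('n) * measure lebesgue (simplex_of v))"
proof -
  have "card (UNIV - {j}) = CARD('n)"
    by (simp add: card_Diff_singleton)
  then obtain \<sigma> where \<sigma>: "bij_betw \<sigma> (UNIV :: 'n set) (UNIV - {j})"
    using finite_same_card_bij[of "UNIV :: 'n set" "UNIV - {j}"] by auto
  then obtain s where s: "\<sigma> s = i"
    using \<open>j \<noteq> i\<close> by (metis DiffI UNIV_I bij_betw_iff_bijections singletonD)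
  define a where "a l = v (\<sigma> l) - v j" for l
  have vol: "measure lebesgue (simplex_of v) = \<bar>det (\<chi> l. a l)\<bar> / fact CARD('n)"
    unfolding a_def by (rule measure_simplex_of[OF \<sigma>])
  then have deta: "det (\<chi> l. a l) \<noteq> 0"
    using nd by (auto simp: measure_simplex_of_edge_matrix)
  have "\<sigma> ` (UNIV - {s}) = UNIV - {j, i}"
    using \<sigma> s by (auto simp: bij_betw_def inj_def)
  then have "(\<lambda>l. v j + a l) ` (UNIV - {s}) = v ` (UNIV - {j, i})"
    unfolding a_def by (simp add: image_image[symmetric, of v \<sigma>])
  moreover have "insert (v j) (v ` (UNIV - {j, i})) = v ` (UNIV - {i})"
    using \<open>j \<noteq> i\<close> by auto
  ultimately have face: "face v i = convex hull (insert (v j) ((\<lambda>l. v j + a l) ` (UNIV - {s})))"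
    by (simp add: face_def)
  have vface: "v l \<in> face v i" if "l \<noteq> i" for l
    using that by (auto simp: face_def intro: hull_inc)
  have si: "\<sigma> l \<noteq> i" if "l \<noteq> s" for l
    using \<sigma> s that by (auto simp: bij_betw_def inj_def)
  have neg: "k \<bullet> (v i - v j) < 0"
    using k vface[OF \<open>j \<noteq> i\<close>] by (simp add: normalized_outward_normal_def)
  then have k0: "k \<noteq> 0" by auto
  have kface: "k \<bullet> (x - y) = 0" if "x \<in> face v i" "y \<in> face v i" for x y
    using k that by (simp add: normalized_outward_normal_def)
  define u where "u = (SOME u. norm u = 1 \<and> (\<forall>x\<in>face v i. \<forall>y\<in>face v i. u \<bullet> (x - y) = 0))"
  have "norm (k /\<^sub>R norm k) = 1 \<and> (\<forall>x\<in>face v i. \<forall>y\<in>face v i. (k /\<^sub>R norm k) \<bullet> (x - y) = 0)"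
    using k0 kface by auto
  then have "norm u = 1 \<and> (\<forall>x\<in>face v i. \<forall>y\<in>face v i. u \<bullet> (x - y) = 0)"
    unfolding u_def by (rule someI)
  then have u: "norm u = 1" "\<And>x y. x \<in> face v i \<Longrightarrow> y \<in> face v i \<Longrightarrow> u \<bullet> (x - y) = 0"
    by auto
  have ua: "u \<bullet> a l = 0" and ka: "k \<bullet> a l = 0" if "l \<noteq> s" for l
    using u(2) kface vface si[OF that] \<open>j \<noteq> i\<close> by (auto simp: a_def)
  have u0: "u \<noteq> 0" using u(1) by auto
  have uu: "u \<bullet> u = 1" using u(1) by (simp add: norm_eq_1)
  define y where "y = k - (k \<bullet> u) *\<^sub>R u"
  have "u \<bullet> y = 0"
    by (simp add: y_def inner_diff_right uu inner_commute)
  then have "y \<in> span (a ` (UNIV - {s}))"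
    using span_others_eq_orthogonal_hyperplane[OF deta u0 ua] by auto
  moreover have "orthogonal y (a l)" if "l \<noteq> s" for l
    by (simp add: orthogonal_def y_def inner_diff_left ua[OF that] ka[OF that])
  then have "orthogonal y z" if "z \<in> a ` (UNIV - {s})" for z
    using that by auto
  ultimately have "orthogonal y y"
    by (metis orthogonal_to_span)
  then have ku: "k = (k \<bullet> u) *\<^sub>R u"
    by (simp add: orthogonal_def y_def)
  have h1: "norm k = \<bar>k \<bullet> u\<bar>"
    by (subst ku) (simp add: u(1) uu)
  have h2: "norm k = \<bar>det (\<chi> l. if l = s then u else a l)\<bar> / fact (CARD('n) - 1)"
    using k unfolding normalized_outward_normal_def hyperplane_volume_def u_def[symmetric] Let_def
    unfolding face measure_prism by simp
  have "\<bar>k \<bullet> a s\<bar> = \<bar>k \<bullet> u\<bar> * \<bar>u \<bullet> a s\<bar>"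
    by (subst ku) (simp add: abs_mult uu)
  then have "\<bar>k \<bullet> a s\<bar> = \<bar>(u \<bullet> a s) * det (\<chi> l. if l = s then u else a l)\<bar> / fact (CARD('n) - 1)"
    by (simp add: h1[symmetric] h2 abs_mult)
  also have "\<dots> = \<bar>det (\<chi> l. a l)\<bar> / fact (CARD('n) - 1)"
    by (simp add: det_eq_height_mult[OF deta u(1) ua])
  also have "\<dots> = real CARD('n) * measure lebesgue (simplex_of v)"
    by (simp add: vol fact_reduce[of "CARD('n)"])
  finally show ?thesis
    using neg by (simp add: a_def s)
qed

section \<open>Eigenvalues of symmetric matrices\<close>

lemma inner_symmetric_matrix:
  fixes A :: "real^'n^'n"
  assumes "transpose A = A"
  shows "x \<bullet> (A *v y) = (A *v x) \<bullet> y"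
  by (metis assms dot_lmul_matrix transpose_matrix_vector)

text \<open>The Rayleigh quotient attains its maximum \<open>\<mu>\<close> on the unit sphere of \<open>W\<close> at some \<open>x\<close>.  Perturbing
  \<open>x\<close> in the direction of the residual \<open>r = \<mu> x - A x\<close>, which lies in \<open>W\<close>, would increase the quotient to
  first order unless \<open>r = 0\<close>.\<close>

lemma symmetric_eigenvector_in_subspace:
  fixes A :: "real^'n^'n"
  assumes sym: "transpose A = A" and W: "subspace W" and inv: "\<And>x. x \<in> W \<Longrightarrow> A *v x \<in> W"
    and "\<exists>x\<in>W. x \<noteq> 0"
  obtains x \<mu> where "x \<in> W" "norm x = 1" "A *v x = \<mu> *\<^sub>R x"
proof -
  let ?S = "W \<inter> sphere 0 1"
  from assms obtain z where z: "z \<in> W" "z \<noteq> 0" by blast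
  have "compact ?S"
    using closed_subspace[OF W] by (intro closed_Int_compact compact_sphere)
  moreover have "z /\<^sub>R norm z \<in> ?S"
    using z W by (auto simp: subspace_scale)
  then have "?S \<noteq> {}" by blast
  moreover have "continuous_on ?S (\<lambda>x. x \<bullet> (A *v x))"
    by (intro continuous_intros matrix_vector_mult_linear_continuous_on)
  ultimately have "\<exists>x\<in>?S. \<forall>y\<in>?S. y \<bullet> (A *v y) \<le> x \<bullet> (A *v x)"
    by (intro continuous_attains_sup)
  then obtain x where "x \<in> ?S" and max: "\<And>y. y \<in> ?S \<Longrightarrow> y \<bullet> (A *v y) \<le> x \<bullet> (A *v x)"
    by blast
  then have x: "x \<in> W" "norm x = 1" by auto
  define \<mu> where "\<mu> = x \<bullet> (A *v x)"
  define r where "r = \<mu> *\<^sub>R x - A *v x"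
  have xx: "x \<bullet> x = 1" using x by (simp add: norm_eq_1)
  have rW: "r \<in> W"
    unfolding r_def using x inv W by (intro subspace_diff subspace_scale)
  have xr: "x \<bullet> r = 0"
    by (simp add: r_def inner_diff_right xx \<mu>_def)
  have psd: "y \<bullet> (A *v y) \<le> \<mu> * (y \<bullet> y)" if "y \<in> W" for y
  proof (cases "y = 0")
    case False
    have "y /\<^sub>R norm y \<in> ?S"
      using that False W by (auto simp: subspace_scale)
    from max[OF this] have "(y \<bullet> (A *v y)) / (norm y)\<^sup>2 \<le> \<mu>"
      by (simp add: \<mu>_def matrix_vector_mult_scaleR power2_eq_square field_simps)
    then show ?thesis
      using False by (simp add: field_simps power2_norm_eq_inner)
  qed simp
  define c where "c = \<mu> * (r \<bullet> r) - r \<bullet> (A *v r)"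
  \<comment> \<open>maximality of the quotient at \<open>x + t r\<close>, compared with its value at \<open>x\<close>\<close>
  have ineq: "0 \<le> 2 * t * (r \<bullet> r) + t\<^sup>2 * c" for t
  proof -
    have "x + t *\<^sub>R r \<in> W"
      using x rW W by (intro subspace_add subspace_scale)
    from psd[OF this] have "x \<bullet> (A *v x) + t * (r \<bullet> (A *v x)) + t * (x \<bullet> (A *v r)) + t * t * (r \<bullet> (A *v r))
        \<le> \<mu> * (1 + t * t * (r \<bullet> r))"
      by (simp add: matrix_vector_right_distrib matrix_vector_mult_scaleR inner_add_left inner_add_right
          xx xr inner_commute[of r x] algebra_simps)
    moreover have "x \<bullet> (A *v r) = r \<bullet> (A *v x)"
      by (metis inner_commute inner_symmetric_matrix sym)
    moreover have "r \<bullet> (A *v x) = - (r \<bullet> r)"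
    proof -
      have "A *v x = \<mu> *\<^sub>R x - r" by (simp add: r_def)
      then show ?thesis by (simp add: inner_diff_right xr inner_commute[of r x])
    qed
    ultimately show ?thesis
      by (simp add: \<mu>_def[symmetric] c_def power2_eq_square algebra_simps)
  qed
  have "r \<bullet> r = 0"
  proof (rule ccontr)
    assume "r \<bullet> r \<noteq> 0"
    then have pos: "r \<bullet> r > 0" by (simp add: order_less_le)
    \<comment> \<open>any positive upper bound \<open>b\<close> of \<open>c\<close> will do: at \<open>t = - (r \<bullet> r) / b\<close> the linear term wins\<close>
    define b where "b = \<bar>c\<bar> + 1"
    have b: "b > 0" "c \<le> b" by (auto simp: b_def)
    from ineq[of "- (r \<bullet> r) / b"] have "0 \<le> - (2 * (r \<bullet> r)\<^sup>2 / b) + (r \<bullet> r)\<^sup>2 / b\<^sup>2 * c"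
      by (simp add: power2_eq_square)
    also have "\<dots> \<le> - (2 * (r \<bullet> r)\<^sup>2 / b) + (r \<bullet> r)\<^sup>2 / b\<^sup>2 * b"
      using b by (intro add_left_mono mult_left_mono) auto
    also have "\<dots> = - ((r \<bullet> r)\<^sup>2 / b)"
      using b by (simp add: power2_eq_square field_simps)
    also have "\<dots> < 0"
      using pos b by simp
    finally show False by simp
  qed
  then have "A *v x = \<mu> *\<^sub>R x"
    by (simp add: r_def)
  with x that show ?thesis by blast
qed

lemma symmetric_orthonormal_eigenvectors:
  fixes A :: "real^'n^'n"
  assumes sym: "transpose A = A"
  shows "m \<le> CARD('n) \<Longrightarrow> \<exists>B. finite B \<and> card B = m \<and> pairwise orthogonal B \<and>
           (\<forall>b\<in>B. norm b = 1 \<and> (\<exists>\<mu>. A *v b = \<mu> *\<^sub>R b))"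
proof (induction m)
  case 0
  show ?case by (rule exI[of _ "{}"]) auto
next
  case (Suc m)
  then obtain B where B: "finite B" "card B = m" "pairwise orthogonal B"
    and eig: "\<And>b. b \<in> B \<Longrightarrow> norm b = 1 \<and> (\<exists>\<mu>. A *v b = \<mu> *\<^sub>R b)"
    by auto
  let ?W = "{x. \<forall>b\<in>B. b \<bullet> x = 0}"
  have "dim B < DIM(real^'n)"
    using dim_le_card'[OF B(1)] B(2) Suc.prems by simp
  then obtain z where "z \<noteq> 0" "span B \<subseteq> {x. z \<bullet> x = 0}"
    using lowdim_subset_hyperplane by blast
  then have z: "z \<in> ?W" "z \<noteq> 0"
    using span_base[of _ B] by (auto simp: inner_commute)
  have W: "subspace ?W"
    by (auto simp: subspace_def inner_add_right)
  have inv: "A *v x \<in> ?W" if "x \<in> ?W" for x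
  proof safe
    fix b assume "b \<in> B"
    then obtain \<mu> where "A *v b = \<mu> *\<^sub>R b" using eig by blast
    then show "b \<bullet> (A *v x) = 0"
      using that \<open>b \<in> B\<close> by (simp add: inner_symmetric_matrix[OF sym])
  qed
  obtain x \<mu> where x: "x \<in> ?W" "norm x = 1" "A *v x = \<mu> *\<^sub>R x"
    using symmetric_eigenvector_in_subspace[OF sym W inv] z by blast
  have "x \<notin> B"
    using x(1,2) by (auto simp: norm_eq_1)
  moreover have "pairwise orthogonal (insert x B)"
    using B(3) x(1) by (auto simp: pairwise_insert orthogonal_def inner_commute)
  ultimately show ?case
    using B eig x by (intro exI[of _ "insert x B"]) auto
qed

lemma symmetric_eigenbasis:
  fixes A :: "real^'n^'n"
  assumes "transpose A = A"
  obtains e :: "'n \<Rightarrow> real^'n" and d :: "'n \<Rightarrow> real"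
  where "\<And>i j. e i \<bullet> e j = (if i = j then 1 else 0)" "\<And>i. A *v e i = d i *\<^sub>R e i"
proof -
  obtain B where B: "finite B" "card B = CARD('n)" "pairwise orthogonal B"
    and eig: "\<And>b. b \<in> B \<Longrightarrow> norm b = 1 \<and> (\<exists>\<mu>. A *v b = \<mu> *\<^sub>R b)"
    using symmetric_orthonormal_eigenvectors[OF assms, of "CARD('n)"] by auto
  obtain e where e: "bij_betw e (UNIV :: 'n set) B"
    using finite_same_card_bij[of "UNIV :: 'n set" B] B by auto
  then have eB: "e i \<in> B" for i
    by (auto simp: bij_betw_def)
  have "\<forall>i. \<exists>\<mu>. A *v e i = \<mu> *\<^sub>R e i"
    using eig eB by blast
  then obtain d where d: "\<And>i. A *v e i = d i *\<^sub>R e i"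
    by metis
  have "e i \<bullet> e j = (if i = j then 1 else 0)" for i j
  proof (cases "i = j")
    case True
    then show ?thesis using eig[OF eB] by (simp add: norm_eq_1)
  next
    case False
    then have "e i \<noteq> e j" using e by (auto simp: bij_betw_def inj_def)
    then show ?thesis
      using False B(3) eB by (auto simp: pairwise_def orthogonal_def)
  qed
  then show ?thesis using that d by blast
qed

text \<open>For a square matrix, orthonormal rows imply orthonormal columns.\<close>

lemma orthonormal_completeness:
  fixes e :: "'n \<Rightarrow> real^'n"
  assumes "\<And>i j. e i \<bullet> e j = (if i = j then 1 else 0)"
  shows "(\<Sum>l\<in>UNIV. e l $ i * e l $ j) = (if i = j then 1 else 0)"
proof -
  define Q where "Q = (\<chi> l i. e l $ i)"
  have "Q ** transpose Q = mat 1"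
    using assms by (simp add: vec_eq_iff matrix_matrix_mult_def transpose_def Q_def mat_def inner_vec_def)
  then have "transpose Q ** Q = mat 1"
    using matrix_left_right_inverse by blast
  then have "(transpose Q ** Q) $ i $ j = (if i = j then 1 else 0)"
    by (simp add: mat_def)
  then show ?thesis
    by (simp add: matrix_matrix_mult_def transpose_def Q_def)
qed

lemma const_poly_sum: "[:sum f A:] = (\<Sum>i\<in>A. [:f i:])"
proof (induction A rule: infinite_finite_induct)
  case (insert x F)
  have "[:f x + sum f F:] = [:f x:] + [:sum f F:]" by simp
  with insert show ?case by simp
qed simp_all

text \<open>The relation \<open>(x I - A) Q = Q (x I - diag d)\<close> is read over the polynomial ring, so that algebraic
  multiplicities come out directly.\<close>

lemma characteristic_poly_eigenbasis:
  fixes A :: "real^'n^'n" and e :: "'n \<Rightarrow> real^'n"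
  assumes e: "\<And>i j. e i \<bullet> e j = (if i = j then 1 else 0)" and d: "\<And>i. A *v e i = d i *\<^sub>R e i"
  shows "characteristic_poly A = (\<Prod>i\<in>UNIV. [:- d i, 1:])"
proof -
  define M :: "real poly^'n^'n" where "M = (\<chi> i j. (if i = j then [:0, 1:] else 0) - [:A $ i $ j:])"
  define Q :: "real poly^'n^'n" where "Q = (\<chi> i j. [:e j $ i:])"
  define E :: "real poly^'n^'n" where "E = (\<chi> i j. if i = j then [:- d i, 1:] else 0)"
  have "Q ** transpose Q = mat 1"
    using orthonormal_completeness[of e, OF e]
    by (simp add: vec_eq_iff matrix_matrix_mult_def transpose_def Q_def mat_def const_poly_sum[symmetric] one_pCons)
  then have "det Q * det (transpose Q) = 1"
    by (metis det_I det_mul)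
  then have Q0: "det Q \<noteq> 0" by auto
  have "(M ** Q) $ i $ j = (Q ** E) $ i $ j" for i j
  proof -
    have "(\<Sum>k\<in>UNIV. A $ i $ k * e j $ k) = d j * e j $ i"
      using d[of j] by (simp add: vec_eq_iff matrix_vector_mult_def)
    then have Ae: "(\<Sum>k\<in>UNIV. [:A $ i $ k:] * [:e j $ k:]) = [:d j * e j $ i:]"
      by (simp add: const_poly_sum[symmetric] mult.commute)
    have "(M ** Q) $ i $ j = (\<Sum>k\<in>UNIV. (if i = k then [:0, 1:] * [:e j $ k:] else 0) - [:A $ i $ k:] * [:e j $ k:])"
      unfolding matrix_matrix_mult_def M_def Q_def by (auto simp: left_diff_distrib intro!: sum.cong)
    also have "\<dots> = [:0, 1:] * [:e j $ i:] - [:d j * e j $ i:]"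
      unfolding sum_subtractf Ae by simp
    also have "\<dots> = [:e j $ i:] * [:- d j, 1:]"
      by simp
    also have "\<dots> = (\<Sum>k\<in>UNIV. if k = j then [:e k $ i:] * [:- d k, 1:] else 0)"
      by (simp only: sum.delta finite UNIV_I if_True)
    also have "\<dots> = (Q ** E) $ i $ j"
      unfolding matrix_matrix_mult_def E_def Q_def vec_lambda_beta by (intro sum.cong) auto
    finally show ?thesis .
  qed
  then have "M ** Q = Q ** E"
    by (simp add: vec_eq_iff)
  then have "det M * det Q = det Q * det E"
    by (metis det_mul)
  then have "det M = det E"
    using Q0 by simp
  also have "det E = (\<Prod>i\<in>UNIV. [:- d i, 1:])"
    by (subst det_diagonal) (auto simp: E_def)
  finally show ?thesis
    by (simp add: characteristic_poly_def M_def)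
qed

lemma sum_singleton_mset: "finite A \<Longrightarrow> (\<Sum>x\<in>A. {#f x#}) = image_mset f (mset_set A)"
  by (induction A rule: finite_induct) auto

lemma eigenvalue_mset_eigenbasis:
  fixes A :: "real^'n^'n" and e :: "'n \<Rightarrow> real^'n"
  assumes "\<And>i j. e i \<bullet> e j = (if i = j then 1 else 0)" and "\<And>i. A *v e i = d i *\<^sub>R e i"
  shows "eigenvalue_mset A = image_mset d (mset_set UNIV)"
  unfolding eigenvalue_mset_def characteristic_poly_eigenbasis[OF assms]
  by (subst proots_prod) (auto simp: sum_singleton_mset)

lemma pair_subset_image_mset_iff:
  fixes d :: "'n::finite \<Rightarrow> 'a"
  shows "{#a, b#} \<subseteq># image_mset d (mset_set UNIV) \<longleftrightarrow> (\<exists>i j. i \<noteq> j \<and> a = d i \<and> b = d j)"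
proof
  assume "{#a, b#} \<subseteq># image_mset d (mset_set UNIV)"
  then have ab: "a \<in># image_mset d (mset_set UNIV) \<and> {#b#} \<subseteq># image_mset d (mset_set UNIV) - {#a#}"
    by (rule insert_subset_eq_iff[THEN iffD1])
  then have b: "b \<in># image_mset d (mset_set UNIV) - {#a#}"
    by (simp only: single_subset_iff)
  from ab obtain i where i: "a = d i" by auto
  have "image_mset d (mset_set UNIV) - {#a#} = image_mset d (mset_set UNIV - {#i#})"
    unfolding i by (subst image_mset_Diff) auto
  also have "mset_set UNIV - {#i#} = mset_set (UNIV - {i})"
    by (subst mset_set_Diff) auto
  finally have "b \<in># image_mset d (mset_set (UNIV - {i}))"
    using b by (simp only:)
  then obtain j where "b = d j" "i \<noteq> j" by auto
  with i show "\<exists>i j. i \<noteq> j \<and> a = d i \<and> b = d j"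
    by (intro exI[of _ i] exI[of _ j] conjI)
next
  assume "\<exists>i j. i \<noteq> j \<and> a = d i \<and> b = d j"
  then obtain i j where ij: "i \<noteq> j" "a = d i" "b = d j" by blast
  have "mset_set {i, j} \<subseteq># mset_set UNIV"
    by (rule subset_imp_msubset_mset_set) auto
  then have "image_mset d (mset_set {i, j}) \<subseteq># image_mset d (mset_set UNIV)"
    by (rule image_mset_subseteq_mono)
  then show "{#a, b#} \<subseteq># image_mset d (mset_set UNIV)"
    using ij by simp
qed

lemma min_eigenvalue_pair_sum_eigenbasis:
  fixes A :: "real^'n^'n" and e :: "'n \<Rightarrow> real^'n"
  assumes "\<And>i j. e i \<bullet> e j = (if i = j then 1 else 0)" and "\<And>i. A *v e i = d i *\<^sub>R e i"
  shows "min_eigenvalue_pair_sum A = Min {d i + d j | i j. i \<noteq> j}"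
  unfolding min_eigenvalue_pair_sum_def eigenvalue_mset_eigenbasis[OF assms] pair_subset_image_mset_iff
  by (rule arg_cong[of _ _ Min]) auto

lemma trace_eigenbasis:
  fixes A :: "real^'n^'n" and e :: "'n \<Rightarrow> real^'n"
  assumes e: "\<And>i j. e i \<bullet> e j = (if i = j then 1 else 0)" and d: "\<And>i. A *v e i = d i *\<^sub>R e i"
  shows "trace A = (\<Sum>i\<in>UNIV. d i)"
proof -
  have "(\<Sum>i\<in>UNIV. d i) = (\<Sum>i\<in>UNIV. e i \<bullet> (A *v e i))"
    by (simp add: d e)
  also have "\<dots> = (\<Sum>i\<in>UNIV. \<Sum>r\<in>UNIV. \<Sum>c\<in>UNIV. A $ r $ c * (e i $ r * e i $ c))"
    by (simp add: inner_vec_def matrix_vector_mult_def sum_distrib_left algebra_simps)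
  also have "\<dots> = (\<Sum>r\<in>UNIV. \<Sum>c\<in>UNIV. \<Sum>i\<in>UNIV. A $ r $ c * (e i $ r * e i $ c))"
    by (subst sum.swap, rule sum.cong[OF refl], rule sum.swap)
  also have "\<dots> = (\<Sum>r\<in>UNIV. \<Sum>c\<in>UNIV. A $ r $ c * (if r = c then 1 else 0))"
    by (simp add: sum_distrib_left[symmetric] orthonormal_completeness[of e, OF e])
  also have "\<dots> = trace A"
    by (simp add: trace_def if_distrib cong: if_cong)
  finally show ?thesis by simp
qed

lemma scalar_matrix_eigenbasis:
  fixes A :: "real^'n^'n" and e :: "'n \<Rightarrow> real^'n"
  assumes e: "\<And>i j. e i \<bullet> e j = (if i = j then 1 else 0)" and d: "\<And>i. A *v e i = c *\<^sub>R e i"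
  shows "A = c *\<^sub>R mat 1"
proof -
  have "A $ r $ s = (c *\<^sub>R mat 1) $ r $ s" for r s
  proof -
    have "(\<Sum>k\<in>UNIV. A $ r $ k * e i $ k) = c * e i $ r" for i
      using d[of i] by (simp add: vec_eq_iff matrix_vector_mult_def)
    then have "(\<Sum>i\<in>UNIV. (\<Sum>k\<in>UNIV. A $ r $ k * e i $ k) * e i $ s) = (\<Sum>i\<in>UNIV. c * (e i $ r * e i $ s))"
      by (simp add: mult.assoc)
    moreover have "(\<Sum>i\<in>UNIV. (\<Sum>k\<in>UNIV. A $ r $ k * e i $ k) * e i $ s)
        = (\<Sum>k\<in>UNIV. A $ r $ k * (\<Sum>i\<in>UNIV. e i $ k * e i $ s))"
      unfolding sum_distrib_left sum_distrib_right by (subst sum.swap) (simp add: mult.assoc)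
    ultimately have "A $ r $ s = c * (if r = s then 1 else 0)"
      by (simp add: sum_distrib_left[symmetric] orthonormal_completeness[of e, OF e] if_distrib cong: if_cong)
    then show ?thesis by (simp add: mat_def)
  qed
  then show ?thesis by (simp add: vec_eq_iff)
qed

lemma ex_distinct_pair:
  assumes "CARD('n) \<ge> 2"
  shows "\<exists>i j :: 'n. i \<noteq> j"
proof (rule ccontr)
  assume "\<not> ?thesis"
  then have "(UNIV :: 'n set) = {undefined}" by auto
  then have "CARD('n) = card {undefined :: 'n}" by (rule arg_cong)
  then show False using assms by simp
qed

lemma min_eigenvalue_pair_sum_scalar:
  assumes "CARD('n) \<ge> 2"
  shows "min_eigenvalue_pair_sum (c *\<^sub>R mat 1 :: real^'n^'n) = 2 * c"
proof -
  have "min_eigenvalue_pair_sum (c *\<^sub>R mat 1 :: real^'n^'n) = Min {c + c | i j :: 'n. i \<noteq> j}"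
    by (rule min_eigenvalue_pair_sum_eigenbasis[of "\<lambda>i. axis i 1"])
       (auto simp: inner_axis_axis scaleR_matrix_vector_assoc[symmetric])
  also have "\<exists>i j :: 'n. i \<noteq> j"
    using assms(1) by (rule ex_distinct_pair)
  then have "{c + c | i j :: 'n. i \<noteq> j} = {2 * c}"
    by auto
  finally show ?thesis by simp
qed

lemma min_eigenvalue_pair_sum_attained:
  fixes A :: "real^'n^'n"
  assumes "CARD('n) \<ge> 2" and sym: "transpose A = A"
  shows "\<exists>(e :: 'n \<Rightarrow> real^'n) d. (\<forall>i j. e i \<bullet> e j = (if i = j then 1 else 0)) \<and>
    (\<forall>i. A *v e i = d i *\<^sub>R e i) \<and> (\<exists>i j. i \<noteq> j \<and> min_eigenvalue_pair_sum A = d i + d j) \<and>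
    (\<forall>i j. i \<noteq> j \<longrightarrow> min_eigenvalue_pair_sum A \<le> d i + d j)"
proof -
  obtain e :: "'n \<Rightarrow> real^'n" and d where e: "\<And>i j. e i \<bullet> e j = (if i = j then 1 else 0)"
    and d: "\<And>i. A *v e i = d i *\<^sub>R e i"
    using symmetric_eigenbasis[OF sym] by blast
  let ?P = "{d i + d j | i j. i \<noteq> j}"
  have min: "min_eigenvalue_pair_sum A = Min ?P"
    by (rule min_eigenvalue_pair_sum_eigenbasis[OF e d])
  have "?P \<subseteq> (\<lambda>(i, j). d i + d j) ` UNIV"
    by auto
  then have fin: "finite ?P"
    by (rule finite_subset) auto
  have "\<exists>i j :: 'n. i \<noteq> j"
    using assms(1) by (rule ex_distinct_pair)
  then have "?P \<noteq> {}" by auto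
  then obtain i j where "i \<noteq> j" "Min ?P = d i + d j"
    using Min_in[OF fin] by blast
  moreover have "Min ?P \<le> d i + d j" if "i \<noteq> j" for i j
    using that by (intro Min_le fin) auto
  ultimately show ?thesis
    unfolding min using e d by (intro exI[of _ e] exI[of _ d]) blast
qed

lemma min_eigenvalue_pair_sum_card_2:
  fixes A :: "real^'n^'n"
  assumes card: "CARD('n) = 2" and "transpose A = A"
  shows "min_eigenvalue_pair_sum A = trace A"
proof -
  have c2: "CARD('n) \<ge> 2" using card by simp
  obtain e :: "'n \<Rightarrow> real^'n" and d i j where e: "\<And>i j. e i \<bullet> e j = (if i = j then 1 else 0)"
    and d: "\<And>i. A *v e i = d i *\<^sub>R e i" and ij: "i \<noteq> j" "min_eigenvalue_pair_sum A = d i + d j"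
    using min_eigenvalue_pair_sum_attained[OF c2 assms(2)] by blast
  have "(UNIV :: 'n set) = {i, j}"
    using card ij(1) by (intro card_seteq[symmetric]) auto
  then have "(\<Sum>l\<in>UNIV. d l) = (\<Sum>l\<in>{i, j}. d l)"
    by (rule arg_cong)
  also have "\<dots> = d i + d j"
    using ij(1) by simp
  finally have "(\<Sum>l\<in>UNIV. d l) = d i + d j" .
  then show ?thesis
    using ij by (simp add: trace_eigenbasis[OF e d])
qed

text \<open>The shifted eigenvalues \<open>f i = d i - c\<close> add up to \<open>0\<close>.  If every pair had nonnegative sum, then adding the
  pairs that contain \<open>i\<close> gives \<open>(n - 2) * f i \<ge> 0\<close>, so all \<open>f i\<close> would be nonnegative with sum \<open>0\<close>.\<close>

lemma min_eigenvalue_pair_sum_less: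
  fixes A :: "real^'n^'n"
  assumes card: "CARD('n) \<ge> 3" and sym: "transpose A = A"
    and tr: "trace A = real CARD('n) * c" and ne: "A \<noteq> c *\<^sub>R mat 1"
  shows "min_eigenvalue_pair_sum A < 2 * c"
proof (rule ccontr)
  assume "\<not> ?thesis"
  then have ge: "2 * c \<le> min_eigenvalue_pair_sum A" by simp
  have c2: "CARD('n) \<ge> 2" using card by linarith
  obtain e :: "'n \<Rightarrow> real^'n" and d where e: "\<And>i j. e i \<bullet> e j = (if i = j then 1 else 0)"
    and d: "\<And>i. A *v e i = d i *\<^sub>R e i"
    and min: "\<And>i j. i \<noteq> j \<Longrightarrow> min_eigenvalue_pair_sum A \<le> d i + d j"
    using min_eigenvalue_pair_sum_attained[OF c2 sym] by blast
  define f where "f i = d i - c" for i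
  have f: "0 \<le> f i + f j" if "i \<noteq> j" for i j
    using min[OF that] ge by (simp add: f_def)
  have sum0: "(\<Sum>i\<in>UNIV. f i) = 0"
    using tr by (simp add: f_def sum_subtractf trace_eigenbasis[OF e d])
  have nonneg: "0 \<le> f i" for i
  proof -
    have "real (CARD('n) - 1) * f i + (\<Sum>j\<in>UNIV - {i}. f j) = (\<Sum>j\<in>UNIV - {i}. f i + f j)"
      by (simp add: sum.distrib card_Diff_singleton)
    also have "0 \<le> \<dots>"
      using f by (intro sum_nonneg) auto
    also have "(\<Sum>j\<in>UNIV - {i}. f j) = - f i"
      using sum0 by (subst sum_diff1) auto
    finally have "0 \<le> (real (CARD('n) - 1) - 1) * f i"
      by (simp add: algebra_simps)
    moreover have "real (CARD('n) - 1) - 1 > 0"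
      using card by linarith
    ultimately show ?thesis
      by (simp add: zero_le_mult_iff)
  qed
  then have "f i = 0" for i
    using sum0 sum_nonneg_eq_0_iff[of UNIV f] by auto
  then have "d i = c" for i
    by (simp add: f_def)
  then have "A = c *\<^sub>R mat 1"
    using scalar_matrix_eigenbasis[of e A c] e d by auto
  then show False using ne by simp
qed

section \<open>Normals of a simplex and the contact matrix\<close>

lemma contact_matrix_form:
  "x \<bullet> (contact_matrix k P *v y) = (\<Sum>i\<in>UNIV. (k i \<bullet> x) * (P $ i \<bullet> y))"
proof -
  have "x \<bullet> (contact_matrix k P *v y) = (\<Sum>a\<in>UNIV. \<Sum>b\<in>UNIV. \<Sum>i\<in>UNIV. (k i $ a * x $ a) * (P $ i $ b * y $ b))"
    by (simp add: contact_matrix_def inner_vec_def matrix_vector_mult_def sum_distrib_left sum_distrib_right algebra_simps)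
  also have "\<dots> = (\<Sum>a\<in>UNIV. \<Sum>i\<in>UNIV. \<Sum>b\<in>UNIV. (k i $ a * x $ a) * (P $ i $ b * y $ b))"
    by (rule sum.cong[OF refl], rule sum.swap)
  also have "\<dots> = (\<Sum>i\<in>UNIV. \<Sum>a\<in>UNIV. \<Sum>b\<in>UNIV. (k i $ a * x $ a) * (P $ i $ b * y $ b))"
    by (rule sum.swap)
  also have "\<dots> = (\<Sum>i\<in>UNIV. (k i \<bullet> x) * (P $ i \<bullet> y))"
    by (simp add: inner_vec_def sum_product)
  finally show ?thesis .
qed

text \<open>Identities for contact matrices are proved as identities of bilinear forms, in which the sum over
  the faces is visible.\<close>

lemma matrix_eq_form:
  fixes A B :: "real^'n^'n"
  assumes "\<And>x y. x \<bullet> (A *v y) = x \<bullet> (B *v y)"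
  shows "A = B"
proof -
  have "A *v y = B *v y" for y
    using assms vector_eq_ldot by blast
  then show ?thesis
    by (simp add: matrix_eq)
qed

lemma trace_contact_matrix: "trace (contact_matrix k P) = (\<Sum>i\<in>UNIV. k i \<bullet> P $ i)"
  unfolding trace_def contact_matrix_def inner_vec_def by simp (rule sum.swap)

lemma linear_contact_matrix: "linear (contact_matrix k)"
  by (rule linearI)
     (simp_all add: contact_matrix_def vec_eq_iff algebra_simps sum.distrib sum_distrib_left)

text \<open>The algebraic content of "normalized outward normals of a nondegenerate simplex".  The constant \<open>V\<close>
  is the volume of the simplex times its dimension.\<close>

locale simplex_normals =
  fixes v k :: "'n::finite option \<Rightarrow> real^'n" and V :: real
  assumes V_pos: "V > 0"
    and normal_edge: "\<And>i j. j \<noteq> i \<Longrightarrow> k i \<bullet> (v i - v j) = - V"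
    and edges_span: "span (range (\<lambda>j. v (Some j) - v None)) = UNIV"
begin

text \<open>The constant term of the hyperplane \<open>k i \<bullet> x = h i\<close> that contains the face opposite \<open>v i\<close>; see
  \<open>affine_hull_face\<close>.\<close>

definition h :: "'n option \<Rightarrow> real" where "h i = k i \<bullet> v i + V"

lemma normal_vertex: "k i \<bullet> v j = h i - (if i = j then V else 0)"
  using normal_edge[of j i] by (auto simp: h_def inner_diff_right)

lemma normal_vertex_diff: "k i \<bullet> (v a - v b) = (if i = b then V else 0) - (if i = a then V else 0)"
  by (simp add: inner_diff_right normal_vertex)

text \<open>The linear part of \<open>x = \<Sum> \<lambda>\<^sub>i(x) v\<^sub>i\<close> for the barycentric coordinates \<open>\<lambda>\<^sub>i\<close>, whose gradients are
  \<open>- k i / V\<close>.  It suffices to check it on edges.\<close>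

lemma normals_vertices: "(\<Sum>i\<in>UNIV. (k i \<bullet> x) *\<^sub>R v i) = - V *\<^sub>R x"
proof -
  have "x \<in> span (range (\<lambda>j. v (Some j) - v None))"
    using edges_span by simp
  moreover have "linear (\<lambda>x. \<Sum>i\<in>UNIV. (k i \<bullet> x) *\<^sub>R v i)"
    by (rule linearI) (simp_all add: inner_add_right scaleR_left_distrib sum.distrib scaleR_sum_right)
  moreover have "linear (\<lambda>x. - V *\<^sub>R x)"
    by (rule linearI) (simp_all add: algebra_simps)
  moreover have "(\<Sum>i\<in>UNIV. (k i \<bullet> y) *\<^sub>R v i) = - V *\<^sub>R y"
    if "y \<in> range (\<lambda>j. v (Some j) - v None)" for y
  proof -
    from that obtain j where y: "y = v (Some j) - v None" by blast
    have "(\<Sum>i\<in>UNIV. (k i \<bullet> y) *\<^sub>R v i)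
        = (\<Sum>i\<in>UNIV. if i = None then V *\<^sub>R v i else 0) - (\<Sum>i\<in>UNIV. if i = Some j then V *\<^sub>R v i else 0)"
      unfolding y normal_vertex_diff sum_subtractf[symmetric]
      by (rule sum.cong) (auto simp: scaleR_left_diff_distrib)
    then show ?thesis
      by (simp add: y scaleR_right_diff_distrib)
  qed
  ultimately show ?thesis
    using linear_eq_on by blast
qed

lemma sum_normals: "(\<Sum>i\<in>UNIV. k i) = 0"
proof -
  have "(\<Sum>i\<in>UNIV. k i) \<bullet> x = 0" for x
  proof -
    have "x \<in> span (range (\<lambda>j. v (Some j) - v None))"
      using edges_span by simp
    then show ?thesis
    proof (induction rule: span_induct)
      case base
      then show ?case by (simp add: subspace_hyperplane)
    next
      case (step y)
      then obtain j where y: "y = v (Some j) - v None" by blast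
      show ?case
        by (simp add: inner_sum_left y normal_vertex_diff sum_subtractf)
    qed
  qed
  then show ?thesis
    by (metis inner_eq_zero_iff)
qed

lemma sum_normals_inner: "(\<Sum>i\<in>UNIV. k i \<bullet> x) = 0"
  using sum_normals by (simp add: inner_sum_left[symmetric])

lemma sum_h: "(\<Sum>i\<in>UNIV. h i) = V"
  using sum_normals_inner[of "v None"] by (simp add: normal_vertex sum_subtractf)

lemma normals_separate:
  assumes "\<And>i. k i \<bullet> x = 0"
  shows "x = 0"
  using normals_vertices[of x] assms V_pos by simp

text \<open>Prescribed inner products with all normals can be realized as soon as they satisfy the one
  relation forced by \<open>sum_normals\<close>.  Used to correct tuples and to choose the translation part of a motion.\<close>

lemma normals_solve:
  assumes "(\<Sum>j\<in>UNIV. c j) = 0"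
  shows "k i \<bullet> (- (1 / V) *\<^sub>R (\<Sum>j\<in>UNIV. c j *\<^sub>R v j)) = c i"
proof -
  have "(\<Sum>j\<in>UNIV. c j * (k i \<bullet> v j)) = (\<Sum>j\<in>UNIV. c j * h i) - (\<Sum>j\<in>UNIV. if i = j then c j * V else 0)"
    unfolding sum_subtractf[symmetric] normal_vertex by (rule sum.cong) (auto simp: algebra_simps)
  also have "(\<Sum>j\<in>UNIV. c j * h i) = 0"
    using assms by (simp add: sum_distrib_right[symmetric])
  finally show ?thesis
    using V_pos by (simp add: inner_sum_right)
qed

lemma normal_nonzero: "k i \<noteq> 0"
proof -
  obtain j where "j \<noteq> i"
    by (metis option.distinct(1))
  then show ?thesis
    using normal_edge[of j i] V_pos by auto
qed

lemma affine_hull_face: "affine hull (face v i) = {x. k i \<bullet> x = h i}"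
proof
  have "v ` (UNIV - {i}) \<subseteq> {x. k i \<bullet> x = h i}"
    by (auto simp: normal_vertex)
  then show "affine hull (face v i) \<subseteq> {x. k i \<bullet> x = h i}"
    unfolding face_def affine_hull_convex_hull by (intro hull_minimal affine_hyperplane)
  show "{x. k i \<bullet> x = h i} \<subseteq> affine hull (face v i)"
  proof
    fix x assume "x \<in> {x. k i \<bullet> x = h i}"
    then have x: "k i \<bullet> x = h i" by simp
    obtain l where l: "l \<noteq> i"
      by (metis option.distinct(1))
    let ?S = "v ` (UNIV - {i})"
    let ?c = "\<lambda>j. k j \<bullet> (x - v l)"
    have ci: "?c i = 0"
      using x l by (simp add: inner_diff_right normal_vertex)
    have "- V *\<^sub>R (x - v l) = (\<Sum>j\<in>UNIV. ?c j *\<^sub>R v j) - (\<Sum>j\<in>UNIV. ?c j) *\<^sub>R v l"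
      by (simp add: normals_vertices sum_normals_inner)
    also have "\<dots> = (\<Sum>j\<in>UNIV. ?c j *\<^sub>R (v j - v l))"
      by (simp add: scaleR_right_diff_distrib sum_subtractf scaleR_sum_left)
    also have "\<dots> \<in> span ((\<lambda>x. - v l + x) ` ?S)"
    proof (intro span_sum)
      fix j
      show "?c j *\<^sub>R (v j - v l) \<in> span ((\<lambda>x. - v l + x) ` ?S)"
      proof (cases "j = i")
        case True
        then show ?thesis using ci by (simp add: span_zero)
      next
        case False
        then have "- v l + v j \<in> (\<lambda>x. - v l + x) ` ?S" by auto
        then show ?thesis
          by (intro span_scale) (simp add: span_base)
      qed
    qed
    finally have "(- 1 / V) *\<^sub>R (- V *\<^sub>R (x - v l)) \<in> span ((\<lambda>x. - v l + x) ` ?S)"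
      by (rule span_scale)
    then have "x - v l \<in> span ((\<lambda>x. - v l + x) ` ?S)"
      using V_pos by simp
    then have "v l + (x - v l) \<in> (\<lambda>x. v l + x) ` span ((\<lambda>x. - v l + x) ` ?S)"
      by (rule imageI)
    moreover have "v l \<in> affine hull ?S"
      using l by (auto intro: hull_inc)
    ultimately show "x \<in> affine hull (face v i)"
      unfolding face_def affine_hull_convex_hull by (simp add: affine_hull_span_gen)
  qed
qed

lemma symmetric_tuples_iff:
  "P \<in> symmetric_tuples v k \<longleftrightarrow>
     (\<forall>i. k i \<bullet> P $ i = h i) \<and> transpose (contact_matrix k P) = contact_matrix k P"
  by (simp add: symmetric_tuples_def affine_hull_face)

lemma trace_symmetric_tuple:
  assumes "P \<in> symmetric_tuples v k"
  shows "trace (contact_matrix k P) = V"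
  using assms by (simp add: trace_contact_matrix symmetric_tuples_iff sum_h)

lemma contact_matrix_centroids: "contact_matrix k (centroids v) = (V / real CARD('n)) *\<^sub>R mat 1"
proof (rule matrix_eq_form)
  fix x y :: "real^'n"
  let ?n = "real CARD('n)"
  define s where "s = (\<Sum>j\<in>UNIV. v j)"
  have c: "centroids v $ i = (1 / ?n) *\<^sub>R (s - v i)" for i
    by (simp add: centroids_def s_def sum_diff1)
  have "x \<bullet> (contact_matrix k (centroids v) *v y)
      = (1 / ?n) * ((\<Sum>i\<in>UNIV. k i \<bullet> x) * (s \<bullet> y) - (\<Sum>i\<in>UNIV. (k i \<bullet> x) *\<^sub>R v i) \<bullet> y)"
    unfolding contact_matrix_form c inner_sum_left[of _ _ y] sum_distrib_left sum_distrib_right sum_subtractf[symmetric]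
    by (rule sum.cong) (auto simp: inner_diff_left algebra_simps)
  then show "x \<bullet> (contact_matrix k (centroids v) *v y) = x \<bullet> ((V / ?n) *\<^sub>R mat 1 *v y)"
    by (simp add: sum_normals_inner normals_vertices scaleR_matrix_vector_assoc[symmetric])
qed

lemma centroids_in_symmetric_tuples: "centroids v \<in> symmetric_tuples v k"
proof -
  have "k i \<bullet> centroids v $ i = h i" for i
  proof -
    have "(\<Sum>j\<in>UNIV - {i}. k i \<bullet> v j) = (\<Sum>j\<in>UNIV - {i}. h i)"
      by (rule sum.cong) (auto simp: normal_vertex)
    also have "\<dots> = real CARD('n) * h i"
      by (simp add: card_Diff_singleton)
    finally show ?thesis
      by (simp add: centroids_def inner_sum_right)
  qed
  then show ?thesis
    by (simp add: symmetric_tuples_iff contact_matrix_centroids transpose_scalar)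
qed

text \<open>Since \<open>\<Sum>k\<^sub>i = 0\<close> is the only relation between the normals, \<open>\<Sum>k\<^sub>i q\<^sub>i\<^sup>T = 0\<close> forces all \<open>q\<^sub>i\<close> to be the same
  vector, which is then orthogonal to all normals.\<close>

lemma contact_matrix_kernel:
  assumes orth: "\<And>i. k i \<bullet> q $ i = 0" and "contact_matrix k q = 0"
  shows "q = 0"
proof -
  have form: "(\<Sum>i\<in>UNIV. (k i \<bullet> x) * (q $ i \<bullet> y)) = 0" for x y
    using assms(2) by (simp add: contact_matrix_form[symmetric])
  have "q $ a \<bullet> y = q $ b \<bullet> y" for a b y
  proof -
    \<comment> \<open>the edge from \<open>v a\<close> to \<open>v b\<close> meets only the normals \<open>k a\<close> and \<open>k b\<close>, with opposite values\<close>
    have "(\<Sum>i\<in>UNIV. (k i \<bullet> (v b - v a)) * (q $ i \<bullet> y))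
        = (\<Sum>i\<in>UNIV. if i = a then V * (q $ i \<bullet> y) else 0) - (\<Sum>i\<in>UNIV. if i = b then V * (q $ i \<bullet> y) else 0)"
      unfolding sum_subtractf[symmetric] normal_vertex_diff by (rule sum.cong) auto
    also have "\<dots> = V * (q $ a \<bullet> y - q $ b \<bullet> y)"
      by (simp add: algebra_simps)
    finally show ?thesis
      using form V_pos by simp
  qed
  then have eq: "q $ a = q $ b" for a b
    using vector_eq_rdot by blast
  have "q $ a = 0" for a
    using orth eq by (intro normals_separate) metis
  then show ?thesis
    by (simp add: vec_eq_iff)
qed

text \<open>By \<open>normals_vertices\<close>, the vectors \<open>- (1 / V) M\<^sup>T v\<^sub>i\<close> have the contact matrix \<open>M\<close>, and
  adding a common vector \<open>w\<close> to all of them does not change it.  The condition for a \<open>w\<close> that makes them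
  orthogonal to the normals is that the trace of \<open>M\<close> vanishes.\<close>

lemma contact_matrix_onto:
  assumes tr: "trace M = 0"
  obtains q where "\<And>i. k i \<bullet> q $ i = 0" "contact_matrix k q = M"
proof -
  define c where "c i = (1 / V) * (k i \<bullet> (transpose M *v v i))" for i
  have "(\<Sum>i\<in>UNIV. k i \<bullet> (transpose M *v v i)) = (\<Sum>a\<in>UNIV. \<Sum>i\<in>UNIV. k i $ a * (transpose M *v v i) $ a)"
    unfolding inner_vec_def by simp (rule sum.swap)
  also have "\<dots> = (\<Sum>a\<in>UNIV. - V * M $ a $ a)"
  proof (rule sum.cong[OF refl])
    fix a :: 'n
    have "(\<Sum>i\<in>UNIV. k i $ a * (transpose M *v v i) $ a)
        = axis a 1 \<bullet> (transpose M *v (\<Sum>i\<in>UNIV. (k i \<bullet> axis a 1) *\<^sub>R v i))"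
      by (simp add: inner_axis' inner_axis linear_sum[OF matrix_vector_mul_linear]
          matrix_vector_mult_scaleR sum_component)
    also have "\<dots> = - V * (transpose M *v axis a 1) $ a"
      unfolding normals_vertices matrix_vector_mult_scaleR inner_scaleR_right by (simp add: inner_axis')
    also have "(transpose M *v axis a 1) $ a = M $ a $ a"
      by (simp add: matrix_vector_mult_basis column_def transpose_def)
    finally show "(\<Sum>i\<in>UNIV. k i $ a * (transpose M *v v i) $ a) = - V * M $ a $ a" .
  qed
  also have "\<dots> = 0"
    using tr by (simp add: trace_def sum_negf sum_distrib_left[symmetric])
  finally have c0: "(\<Sum>i\<in>UNIV. c i) = 0"
    by (simp add: c_def sum_distrib_left[symmetric] del: times_divide_eq_left)
  define w where "w = - (1 / V) *\<^sub>R (\<Sum>j\<in>UNIV. c j *\<^sub>R v j)"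
  define q where "q = (\<chi> i. w - (1 / V) *\<^sub>R (transpose M *v v i))"
  have "k i \<bullet> w = c i" for i
    unfolding w_def by (rule normals_solve[OF c0])
  then have "k i \<bullet> q $ i = 0" for i
    by (simp add: q_def inner_diff_right c_def)
  moreover have "contact_matrix k q = M"
  proof (rule matrix_eq_form)
    fix x y :: "real^'n"
    have qy: "q $ i \<bullet> y = w \<bullet> y - (1 / V) * (v i \<bullet> (M *v y))" for i
      by (simp add: q_def inner_diff_left transpose_matrix_vector dot_lmul_matrix)
    have "x \<bullet> (contact_matrix k q *v y)
        = (\<Sum>i\<in>UNIV. k i \<bullet> x) * (w \<bullet> y) - (1 / V) * ((\<Sum>i\<in>UNIV. (k i \<bullet> x) *\<^sub>R v i) \<bullet> (M *v y))"
      unfolding contact_matrix_form qy inner_sum_left[of _ _ "M *v y"] sum_distrib_left sum_distrib_right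
        sum_subtractf[symmetric]
      by (rule sum.cong) (auto simp: algebra_simps)
    also have "\<dots> = x \<bullet> (M *v y)"
      using V_pos by (simp add: sum_normals_inner normals_vertices)
    finally show "x \<bullet> (contact_matrix k q *v y) = x \<bullet> (M *v y)" .
  qed
  ultimately show ?thesis using that by blast
qed

lemma eq_centroids_if_scalar:
  assumes P: "P \<in> symmetric_tuples v k" and "contact_matrix k P = (V / real CARD('n)) *\<^sub>R mat 1"
  shows "P = centroids v"
proof -
  have "contact_matrix k (P - centroids v) = 0"
    using assms(2) by (simp add: linear_diff[OF linear_contact_matrix] contact_matrix_centroids)
  moreover have "k i \<bullet> (P - centroids v) $ i = 0" for i
    using P centroids_in_symmetric_tuples by (simp add: symmetric_tuples_iff inner_diff_right)
  ultimately have "P - centroids v = 0"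
    by (intro contact_matrix_kernel)
  then show ?thesis by simp
qed

lemma interior_simplex_subset: "interior (simplex_of v) \<subseteq> {x. k i \<bullet> x < h i}"
proof -
  have "range v \<subseteq> {x. k i \<bullet> x \<le> h i}"
    using V_pos by (auto simp: normal_vertex)
  then have "simplex_of v \<subseteq> {x. k i \<bullet> x \<le> h i}"
    unfolding simplex_of_def by (intro hull_minimal convex_halfspace_le)
  then have "interior (simplex_of v) \<subseteq> interior {x. k i \<bullet> x \<le> h i}"
    by (rule interior_mono)
  then show ?thesis
    using normal_nonzero by simp
qed

end

section \<open>Dimension of the space of contact tuples\<close>

lemma card_linear_order_pairs:
  fixes f :: "'n::finite \<Rightarrow> nat"
  assumes "inj f"
  shows "2 * card {(i, j). f i \<le> f j} = CARD('n) * (CARD('n) + 1)"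
proof -
  let ?U = "{(i, j). f i \<le> f j}" and ?L = "{(i, j). f j \<le> f i}"
  have "?L = prod.swap ` ?U"
    by (auto simp: image_iff)
  then have "card ?L = card ?U"
    by (simp add: card_image)
  moreover have "?U \<union> ?L = UNIV"
    by auto
  moreover have "?U \<inter> ?L = (\<lambda>i. (i, i)) ` UNIV"
    using assms by (auto simp: inj_def)
  moreover have "card ?U + card ?L = card (?U \<union> ?L) + card (?U \<inter> ?L)"
    by (rule card_Un_Int) auto
  ultimately show ?thesis
    by (simp add: card_image inj_on_def card_cartesian_product flip: UNIV_Times_UNIV)
qed

lemma subspace_symmetric: "subspace {M :: real^'n^'n. transpose M = M}"
  by (auto simp: subspace_def transpose_def vec_eq_iff)

lemma dim_injective_image_subspace:
  fixes f :: "'a::euclidean_space \<Rightarrow> 'b::euclidean_space"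
  assumes "linear f" "subspace S" "inj_on f S"
  shows "dim (f ` S) = dim S"
proof -
  have "span S = S"
    using assms(2) by (simp only: span_eq_iff)
  then show ?thesis
    using assms(3) by (intro dim_image_eq[OF assms(1)]) (simp only:)
qed

text \<open>Keeping the entries on and above the diagonal identifies the symmetric matrices with
  a coordinate subspace.  The order on the indices is an arbitrary one, taken from an injection \<open>f\<close> into the natural
  numbers.\<close>

lemma dim_symmetric:
  "dim {M :: real^'n^'n. transpose M = M} = CARD('n) * (CARD('n) + 1) div 2"
proof -
  obtain f :: "'n \<Rightarrow> nat" where f: "inj f"
    using finite_imp_inj_to_nat_seg[of "UNIV :: 'n set"] by auto
  let ?S = "{M :: real^'n^'n. transpose M = M}"
  let ?b = "\<lambda>(i, j). axis i (axis j 1) :: real^'n^'n"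
  define D where "D = ?b ` {(i, j). f i \<le> f j}"
  define L where "L M = (\<chi> i j. if f i \<le> f j then M $ i $ j else 0)" for M :: "real^'n^'n"
  have lin: "linear L"
    by (rule linearI) (auto simp: L_def vec_eq_iff)
  have symD: "M $ i $ j = M $ j $ i" if "M \<in> ?S" for M :: "real^'n^'n" and i j
  proof -
    have "M $ i $ j = transpose M $ i $ j" using that by simp
    then show ?thesis by (simp add: transpose_def)
  qed
  have "inj_on L ?S"
  proof (rule inj_onI)
    fix M N assume MN: "M \<in> ?S" "N \<in> ?S" "L M = L N"
    have up: "M $ i $ j = N $ i $ j" if "f i \<le> f j" for i j
    proof -
      have "L M $ i $ j = L N $ i $ j" using MN(3) by simp
      then show ?thesis using that by (simp add: L_def)
    qed
    have "M $ i $ j = N $ i $ j" for i j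
    proof (cases "f i \<le> f j")
      case False
      then show ?thesis
        using up[of j i] symD[OF MN(1), of i j] symD[OF MN(2), of i j] by simp
    qed (rule up)
    then show "M = N" by (simp add: vec_eq_iff)
  qed
  then have "dim (L ` ?S) = dim ?S"
    by (rule dim_injective_image_subspace[OF lin subspace_symmetric])
  have inj_b: "inj ?b"
    by (auto simp: inj_def axis_eq_axis)
  have comp: "M \<bullet> axis i (axis j 1) = M $ i $ j" for M :: "real^'n^'n" and i j
    by (simp add: inner_axis)
  have "L ` ?S = {x. \<forall>i\<in>Basis. i \<notin> D \<longrightarrow> x \<bullet> i = 0}"
  proof (intro equalityI subsetI)
    fix x assume "x \<in> L ` ?S"
    then obtain M where x: "x = L M" by blast
    have "x \<bullet> ?b (i, j) = 0" if "?b (i, j) \<notin> D" for i j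
      using that by (auto simp: x comp L_def D_def)
    then show "x \<in> {x. \<forall>i\<in>Basis. i \<notin> D \<longrightarrow> x \<bullet> i = 0}"
      by (auto simp: Basis_vec_def)
  next
    fix x :: "real^'n^'n" assume "x \<in> {x. \<forall>i\<in>Basis. i \<notin> D \<longrightarrow> x \<bullet> i = 0}"
    then have x: "x \<bullet> b = 0" if "b \<in> Basis" "b \<notin> D" for b
      using that by blast
    have low: "x $ i $ j = 0" if "\<not> f i \<le> f j" for i j
    proof -
      have "?b (i, j) \<notin> D"
        using that inj_b by (auto simp: D_def axis_eq_axis)
      moreover have "?b (i, j) \<in> Basis"
        by (auto simp: Basis_vec_def)
      ultimately show ?thesis
        using x[of "?b (i, j)"] by (simp add: comp)
    qed
    define M where "M = (\<chi> i j. if f i \<le> f j then x $ i $ j else x $ j $ i)"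
    have "M $ i $ j = M $ j $ i" for i j
      using f by (cases "f i = f j") (auto simp: M_def inj_def)
    then have "M \<in> ?S"
      by (simp add: transpose_def vec_eq_iff)
    moreover have "L M = x"
      using low by (auto simp: L_def M_def vec_eq_iff)
    ultimately show "x \<in> L ` ?S" by blast
  qed
  moreover have "D \<subseteq> Basis"
    by (auto simp: D_def Basis_vec_def)
  ultimately have "dim (L ` ?S) = card D"
    using dim_substandard[of D] by (simp only:)
  also have "card D = card {(i, j). f i \<le> f j}"
    unfolding D_def using inj_b by (intro card_image) (auto intro: inj_on_subset)
  finally show ?thesis
    using \<open>dim (L ` ?S) = dim ?S\<close> card_linear_order_pairs[OF f] by simp
qed

lemma trace_eq_inner: "trace M = mat 1 \<bullet> (M :: real^'n^'n)"
  by (simp add: trace_def inner_vec_def mat_def if_distrib[of "\<lambda>x. x * _"] cong: if_cong)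

lemma dim_symmetric_trace_zero:
  "int (dim {M :: real^'n^'n. transpose M = M \<and> trace M = 0}) = int (CARD('n) * (CARD('n) + 1) div 2) - 1"
proof -
  let ?S = "{M :: real^'n^'n. transpose M = M}"
  let ?H = "{M :: real^'n^'n. mat 1 \<bullet> M = 0}"
  have eq: "{M :: real^'n^'n. transpose M = M \<and> trace M = 0} = ?S \<inter> ?H"
    by (auto simp: trace_eq_inner)
  have "subspace (?S \<inter> ?H)"
    by (intro subspace_inter subspace_symmetric subspace_hyperplane)
  then have "int (dim (?S \<inter> ?H)) = aff_dim (?S \<inter> ?H)"
    by (simp add: aff_dim_subspace)
  also have "\<dots> = aff_dim ?S - 1"
  proof -
    have "0 \<in> ?S \<inter> ?H"
      by (simp add: transpose_def vec_eq_iff)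
    then have "?S \<inter> ?H \<noteq> {}" by blast
    moreover have "mat 1 \<in> ?S"
      by (simp add: transpose_mat)
    moreover have "mat 1 \<notin> ?H"
      by (simp add: trace_eq_inner[symmetric] trace_I del: inner_eq_zero_iff)
    ultimately have "?S \<inter> ?H \<noteq> {}" "\<not> ?S \<subseteq> ?H"
      by blast+
    then show ?thesis
      using aff_dim_affine_Int_hyperplane[OF subspace_imp_affine[OF subspace_symmetric[where 'n = 'n]], where a = "mat 1" and b = 0]
      by (simp only: if_False)
  qed
  also have "aff_dim ?S = int (CARD('n) * (CARD('n) + 1) div 2)"
    by (simp add: aff_dim_subspace subspace_symmetric dim_symmetric)
  finally show ?thesis
    unfolding eq .
qed

context simplex_normals
begin

text \<open>\<open>X\<close> is the translate by the centroids of the linear space on which the contact matrix is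
  injective; \<open>affine_and_aff_dim_symmetric_tuples\<close> counts the dimension of its image.\<close>

lemma symmetric_tuples_translate:
  "symmetric_tuples v k = (+) (centroids v) `
     {q. (\<forall>i. k i \<bullet> q $ i = 0) \<and> transpose (contact_matrix k q) = contact_matrix k q}"
  (is "_ = _ ` ?Q")
proof -
  note G = centroids_in_symmetric_tuples[unfolded symmetric_tuples_iff]
  have tr: "transpose (A + B) = transpose A + transpose B" for A B :: "real^'n^'n"
    by (simp add: transpose_def vec_eq_iff)
  have iff: "centroids v + q \<in> symmetric_tuples v k \<longleftrightarrow> q \<in> ?Q" for q
    using G by (simp add: symmetric_tuples_iff inner_add_right linear_add[OF linear_contact_matrix] tr)
  show ?thesis
  proof (intro equalityI subsetI)
    fix P assume "P \<in> symmetric_tuples v k"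
    then have "P - centroids v \<in> ?Q" using iff[of "P - centroids v"] by simp
    then have "centroids v + (P - centroids v) \<in> (+) (centroids v) ` ?Q" by (rule imageI)
    then show "P \<in> (+) (centroids v) ` ?Q" by simp
  next
    fix P assume "P \<in> (+) (centroids v) ` ?Q"
    then obtain q where q: "q \<in> ?Q" "P = centroids v + q" by (rule imageE)
    show "P \<in> symmetric_tuples v k" unfolding q(2) iff by (rule q(1))
  qed
qed

lemma affine_and_aff_dim_symmetric_tuples:
  "affine (symmetric_tuples v k) \<and>
   aff_dim (symmetric_tuples v k) = int (CARD('n) * (CARD('n) + 1) div 2) - 1"
proof -
  let ?Q = "{q. (\<forall>i. k i \<bullet> q $ i = 0) \<and> transpose (contact_matrix k q) = contact_matrix k q}"
  let ?S = "{M :: real^'n^'n. transpose M = M \<and> trace M = 0}"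
  note lin = linear_contact_matrix[of k]
  have tr: "transpose (A + B) = transpose A + transpose B" "transpose (c *\<^sub>R A) = c *\<^sub>R transpose A"
    "transpose 0 = (0 :: real^'n^'n)" for A B :: "real^'n^'n" and c
    by (simp_all add: transpose_def vec_eq_iff)
  have sub: "subspace ?Q"
    by (rule subspaceI)
       (simp_all add: linear_add[OF lin] linear_scale[OF lin] linear_0[OF lin] tr inner_add_right)
  have "inj_on (contact_matrix k) ?Q"
    unfolding linear_injective_on_subspace_0[OF lin sub] using contact_matrix_kernel by blast
  then have "dim (contact_matrix k ` ?Q) = dim ?Q"
    by (rule dim_injective_image_subspace[OF lin sub])
  moreover have "contact_matrix k ` ?Q = ?S"
  proof (intro equalityI subsetI)
    fix M assume "M \<in> contact_matrix k ` ?Q"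
    then show "M \<in> ?S" by (auto simp: trace_contact_matrix)
  next
    fix M :: "real^'n^'n" assume M: "M \<in> ?S"
    then obtain q where "\<And>i. k i \<bullet> q $ i = 0" "contact_matrix k q = M"
      using contact_matrix_onto by blast
    then show "M \<in> contact_matrix k ` ?Q" using M by (auto intro!: image_eqI[of _ _ q])
  qed
  ultimately have "aff_dim ?Q = int (CARD('n) * (CARD('n) + 1) div 2) - 1"
    using dim_symmetric_trace_zero[where 'n = 'n] sub by (simp add: aff_dim_subspace)
  moreover have "affine ((+) (centroids v) ` ?Q)"
    using subspace_imp_affine[OF sub] by (simp add: affine_translation[symmetric])
  ultimately show ?thesis
    unfolding symmetric_tuples_translate by (simp add: aff_dim_translation_eq)
qed

end

section \<open>Rotations in a plane and loss of immobilization\<close>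

text \<open>For orthonormal \<open>e\<close> and \<open>f\<close>: the rotation by \<open>\<theta>\<close> in their plane, from \<open>e\<close> towards \<open>f\<close>,
  fixing the orthogonal complement.\<close>

definition plane_rotation :: "real^'n \<Rightarrow> real^'n \<Rightarrow> real \<Rightarrow> real^'n^'n" where
  "plane_rotation e f \<theta> = (\<chi> i j. (if i = j then 1 else 0)
     + (cos \<theta> - 1) * (e $ i * e $ j + f $ i * f $ j) + sin \<theta> * (f $ i * e $ j - e $ i * f $ j))"

lemma plane_rotation_apply:
  "plane_rotation e f \<theta> *v x = x + ((cos \<theta> - 1) * (e \<bullet> x) - sin \<theta> * (f \<bullet> x)) *\<^sub>R e
     + ((cos \<theta> - 1) * (f \<bullet> x) + sin \<theta> * (e \<bullet> x)) *\<^sub>R f"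
proof -
  have "(plane_rotation e f \<theta> *v x) $ i = (\<Sum>j\<in>UNIV. if i = j then x $ j else 0)
      + (cos \<theta> - 1) * (e $ i * (e \<bullet> x) + f $ i * (f \<bullet> x)) + sin \<theta> * (f $ i * (e \<bullet> x) - e $ i * (f \<bullet> x))" for i
    unfolding plane_rotation_def matrix_vector_mult_def inner_vec_def sum_distrib_left
      sum.distrib[symmetric] sum_subtractf[symmetric] vec_lambda_beta
    by (rule sum.cong) (auto simp: algebra_simps)
  then show ?thesis
    by (simp add: vec_eq_iff algebra_simps)
qed

lemma plane_rotation_0: "plane_rotation e f 0 = mat 1"
  by (simp add: plane_rotation_def mat_def)

lemma transpose_plane_rotation: "transpose (plane_rotation e f \<theta>) = plane_rotation e f (- \<theta>)"
  by (auto simp: plane_rotation_def transpose_def vec_eq_iff algebra_simps)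

lemma plane_rotation_mult:
  assumes "e \<bullet> e = 1" "f \<bullet> f = 1" "e \<bullet> f = 0"
  shows "plane_rotation e f \<alpha> ** plane_rotation e f \<beta> = plane_rotation e f (\<alpha> + \<beta>)"
proof -
  have fe: "f \<bullet> e = 0" using assms(3) by (simp add: inner_commute)
  have "plane_rotation e f \<alpha> *v (plane_rotation e f \<beta> *v x) = plane_rotation e f (\<alpha> + \<beta>) *v x" for x
  proof -
    define y where "y = plane_rotation e f \<beta> *v x"
    have ey: "e \<bullet> y = cos \<beta> * (e \<bullet> x) - sin \<beta> * (f \<bullet> x)"
      by (simp add: y_def plane_rotation_apply inner_add_right assms fe algebra_simps)
    have fy: "f \<bullet> y = cos \<beta> * (f \<bullet> x) + sin \<beta> * (e \<bullet> x)"
      by (simp add: y_def plane_rotation_apply inner_add_right assms fe algebra_simps)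
    have "plane_rotation e f \<alpha> *v y = plane_rotation e f (\<alpha> + \<beta>) *v x"
      unfolding plane_rotation_apply[of e f \<alpha> y] ey fy
      unfolding y_def plane_rotation_apply cos_add sin_add
      by (simp add: vec_eq_iff algebra_simps)
    then show ?thesis by (simp add: y_def)
  qed
  then show ?thesis
    by (simp add: matrix_eq matrix_vector_mul_assoc[symmetric])
qed

text \<open>The determinant of an orthogonal matrix is \<open>1\<close> or \<open>-1\<close>, and a rotation is the square of the rotation
  by half the angle.\<close>

lemma rotation_matrix_plane_rotation:
  assumes "e \<bullet> e = 1" "f \<bullet> f = 1" "e \<bullet> f = 0"
  shows "rotation_matrix (plane_rotation e f \<theta>)"
proof -
  have orth: "orthogonal_matrix (plane_rotation e f \<theta>)" for \<theta>
    by (simp add: orthogonal_matrix transpose_plane_rotation plane_rotation_mult[OF assms] plane_rotation_0)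
  have "det (plane_rotation e f \<theta>) = det (plane_rotation e f (\<theta> / 2)) * det (plane_rotation e f (\<theta> / 2))"
    by (simp add: det_mul[symmetric] plane_rotation_mult[OF assms])
  also have "\<dots> = 1"
    using det_orthogonal_matrix[OF orth[of "\<theta> / 2"]] by auto
  finally show ?thesis
    using orth by (simp add: rotation_matrix_def)
qed

lemma plane_rotation_neq_id:
  assumes "e \<bullet> e = 1" "e \<bullet> f = 0" "0 < \<theta>" "\<theta> \<le> pi"
  shows "plane_rotation e f \<theta> \<noteq> mat 1"
proof
  assume "plane_rotation e f \<theta> = mat 1"
  then have "e \<bullet> (plane_rotation e f \<theta> *v e) = e \<bullet> e"
    by simp
  then have "cos \<theta> = 1"
    using assms by (simp add: plane_rotation_apply inner_add_right inner_commute[of f e])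
  moreover have "cos \<theta> < cos 0"
    using assms by (intro cos_monotone_0_pi) auto
  ultimately show False by simp
qed

lemma continuous_plane_rotation: "continuous_on S (plane_rotation e f)"
proof -
  have "continuous_on S (\<lambda>\<theta>. plane_rotation e f \<theta> $ i $ j)" for i j
    unfolding plane_rotation_def vec_lambda_beta by (intro continuous_intros)
  then have "continuous_on S (\<lambda>\<theta>. \<chi> i j. plane_rotation e f \<theta> $ i $ j)"
    by (intro continuous_on_vec_lambda)
  then show ?thesis by simp
qed

context simplex_normals
begin

text \<open>The sum is \<open>tr (R A\<^sup>T) - tr A\<close>; the terms with \<open>sin \<theta>\<close> vanish because \<open>e \<bullet> A f\<close> and \<open>f \<bullet> A e\<close> do.\<close>

lemma sum_normals_plane_rotation:
  assumes "e \<bullet> e = 1" "f \<bullet> f = 1" "e \<bullet> f = 0"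
    and "contact_matrix k P *v e = a *\<^sub>R e" "contact_matrix k P *v f = b *\<^sub>R f"
  shows "(\<Sum>i\<in>UNIV. k i \<bullet> (plane_rotation e f \<theta> *v P $ i - P $ i)) = (cos \<theta> - 1) * (a + b)"
proof -
  have "(\<Sum>i\<in>UNIV. k i \<bullet> (plane_rotation e f \<theta> *v P $ i - P $ i))
     = (cos \<theta> - 1) * (\<Sum>i\<in>UNIV. (k i \<bullet> e) * (P $ i \<bullet> e)) - sin \<theta> * (\<Sum>i\<in>UNIV. (k i \<bullet> e) * (P $ i \<bullet> f))
     + (cos \<theta> - 1) * (\<Sum>i\<in>UNIV. (k i \<bullet> f) * (P $ i \<bullet> f)) + sin \<theta> * (\<Sum>i\<in>UNIV. (k i \<bullet> f) * (P $ i \<bullet> e))"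
    unfolding sum_distrib_left sum_subtractf[symmetric] sum.distrib[symmetric]
    by (rule sum.cong)
       (auto simp: plane_rotation_apply inner_add_right inner_diff_right inner_commute algebra_simps)
  also have "\<dots> = (cos \<theta> - 1) * (a + b)"
    unfolding contact_matrix_form[symmetric] using assms
    by (simp add: inner_commute[of f e] algebra_simps)
  finally show ?thesis .
qed

text \<open>The motions \<open>g \<theta>\<close> rotate by \<open>\<theta>\<close> and then translate by the vector \<open>t \<theta>\<close> that brings each contact
  point back to the hyperplane of its face, so that no point enters the interior.\<close>

lemma not_immobilizes_if_eigenvalue_pair_vanishes:
  assumes P: "P \<in> symmetric_tuples v k"
    and ef: "e \<bullet> e = 1" "f \<bullet> f = 1" "e \<bullet> f = 0"
    and eig: "contact_matrix k P *v e = a *\<^sub>R e" "contact_matrix k P *v f = b *\<^sub>R f" "a + b = 0"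
  shows "\<not> immobilizes v P"
proof
  assume "immobilizes v P"
  then obtain U where U: "openin (top_of_set rigid_motions) U" "(mat 1, 0) \<in> U"
    and imm: "\<And>g. g \<in> U \<Longrightarrow> g \<noteq> (mat 1, 0) \<Longrightarrow> \<exists>i. apply_motion g (P $ i) \<in> interior (simplex_of v)"
    unfolding immobilizes_def by blast
  define c where "c \<theta> i = - (k i \<bullet> (plane_rotation e f \<theta> *v P $ i - P $ i))" for \<theta> i
  define t where "t \<theta> = - (1 / V) *\<^sub>R (\<Sum>j\<in>UNIV. c \<theta> j *\<^sub>R v j)" for \<theta>
  define g where "g \<theta> = (plane_rotation e f \<theta>, t \<theta>)" for \<theta>
  have "(\<Sum>j\<in>UNIV. c \<theta> j) = 0" for \<theta>
    by (simp add: c_def sum_negf sum_normals_plane_rotation[OF ef eig(1,2)] eig(3))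
  \<comment> \<open>solvable since the displacements \<open>c \<theta>\<close> add up to \<open>(1 - cos \<theta>) * (a + b) = 0\<close>\<close>
  then have kt: "k i \<bullet> t \<theta> = c \<theta> i" for i \<theta>
    unfolding t_def by (rule normals_solve)
  have stay: "apply_motion (g \<theta>) (P $ i) \<notin> interior (simplex_of v)" for i \<theta>
  proof -
    have "k i \<bullet> apply_motion (g \<theta>) (P $ i) = k i \<bullet> P $ i"
      by (simp add: apply_motion_def g_def inner_add_right kt c_def inner_diff_right)
    also have "\<dots> = h i"
      using P by (simp add: symmetric_tuples_iff)
    finally show ?thesis
      using interior_simplex_subset[of i] by auto
  qed
  have g0: "g 0 = (mat 1, 0)"
    by (simp add: g_def t_def c_def plane_rotation_0)
  have "continuous_on UNIV (\<lambda>\<theta>. plane_rotation e f \<theta> *v P $ i)" for i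
    unfolding plane_rotation_apply by (intro continuous_intros)
  then have "continuous_on UNIV g"
    unfolding g_def t_def c_def
    by (intro continuous_intros continuous_plane_rotation)
  then have cont: "isCont g 0"
    by (simp add: continuous_on_eq_continuous_at)
  obtain T where T: "open T" "U = rigid_motions \<inter> T"
    using U(1) by (auto simp: openin_open)
  have "(g \<longlongrightarrow> g 0) (at 0)"
    using cont by (simp add: isCont_def)
  then have "\<forall>\<^sub>F \<theta> in at 0. g \<theta> \<in> T"
    using T U(2) g0 by (intro topological_tendstoD) auto
  then obtain d where d: "d > 0" "\<And>\<theta>. \<theta> \<noteq> 0 \<Longrightarrow> dist \<theta> 0 < d \<Longrightarrow> g \<theta> \<in> T"
    unfolding eventually_at by blast
  define \<theta> where "\<theta> = min (d / 2) 1"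
  have \<theta>: "0 < \<theta>" "\<theta> < d" "\<theta> \<le> pi"
    using d(1) pi_gt3 by (auto simp: \<theta>_def min_def)
  have "g \<theta> \<in> T"
    using d(2)[of \<theta>] \<theta> by (simp add: dist_real_def)
  moreover have "g \<theta> \<in> rigid_motions"
    by (simp add: g_def rigid_motions_def rotation_matrix_plane_rotation[OF ef])
  moreover have "g \<theta> \<noteq> (mat 1, 0)"
    using plane_rotation_neq_id[OF ef(1,3) \<theta>(1,3)] by (simp add: g_def)
  ultimately show False
    using imm stay T(2) by blast
qed

end

lemma simplex_normals_normalized:
  fixes v k :: "'n::finite option \<Rightarrow> real^'n"
  assumes nd: "det (edge_matrix v) \<noteq> 0"
    and normals: "\<And>i. normalized_outward_normal v i (k i)"
  shows "simplex_normals v k (real CARD('n) * measure lebesgue (simplex_of v))"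
proof
  show "0 < real CARD('n) * measure lebesgue (simplex_of v)"
    using nd by (simp add: measure_simplex_of_edge_matrix)
  show "k i \<bullet> (v i - v j) = - (real CARD('n) * measure lebesgue (simplex_of v))" if "j \<noteq> i" for i j
    by (rule normal_inner_edge[OF nd normals that])
  have "columns (edge_matrix v) = range (\<lambda>j. v (Some j) - v None)"
    by (auto simp: columns_def column_def edge_matrix_def vec_eq_iff image_def)
  moreover have "span (columns (edge_matrix v)) = UNIV"
    using nd invertible_det_nz[of "edge_matrix v"] matrix_right_invertible_span_columns[of "edge_matrix v"]
    by (auto simp: invertible_def span_vec_eq)
  ultimately show "span (range (\<lambda>j. v (Some j) - v None)) = UNIV"
    by simp
qed

theorem mainTheorem5:
  fixes v k :: "'n::finite option \<Rightarrow> real^'n"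
  assumes dim: "CARD('n) \<ge> 2"
    and nondegenerate_oriented: "det (edge_matrix v) > 0"
    and normals: "\<And>i. normalized_outward_normal v i (k i)"
  defines "X \<equiv> symmetric_tuples v k"
    and "G \<equiv> centroids v"
    and "vol \<equiv> measure lebesgue (simplex_of v)"
    and "m \<equiv> \<lambda>P. min_eigenvalue_pair_sum (contact_matrix k P)"
  shows "affine X \<and> aff_dim X = int (CARD('n) * (CARD('n) + 1) div 2) - 1 \<and> G \<in> X \<and>
    m G = 2 * vol \<and>
    (\<forall>N. openin (top_of_set X) N \<and> G \<in> N \<and> (\<forall>P\<in>N. immobilizes v P) \<longrightarrow>
       (\<forall>P\<in>N. P \<noteq> G \<longrightarrow> (if CARD('n) = 2 then m P = 2 * vol else m P < 2 * vol))) \<and>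
    (\<forall>P\<in>X. P \<noteq> G \<and> (\<forall>i. P $ i \<in> rel_interior (face v i)) \<and> m P = 0 \<longrightarrow> \<not> immobilizes v P)"
proof -
  have nd: "det (edge_matrix v) \<noteq> 0"
    using nondegenerate_oriented by simp
  interpret simplex_normals v k "real CARD('n) * vol"
    unfolding vol_def by (rule simplex_normals_normalized[OF nd normals])
  have AG: "contact_matrix k G = vol *\<^sub>R mat 1"
    unfolding G_def contact_matrix_centroids by simp
  have sym: "transpose (contact_matrix k P) = contact_matrix k P" if "P \<in> X" for P
    using that by (simp add: X_def symmetric_tuples_iff)
  have tr: "trace (contact_matrix k P) = real CARD('n) * vol" if "P \<in> X" for P
    using that unfolding X_def by (rule trace_symmetric_tuple)
  have mG: "m G = 2 * vol"
    unfolding m_def AG by (rule min_eigenvalue_pair_sum_scalar[OF dim])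
  have decrease: "if CARD('n) = 2 then m P = 2 * vol else m P < 2 * vol" if P: "P \<in> X" "P \<noteq> G" for P
  proof (cases "CARD('n) = 2")
    case True
    then show ?thesis
      using min_eigenvalue_pair_sum_card_2[OF True sym[OF P(1)]] tr[OF P(1)] by (simp add: m_def)
  next
    case False
    have "contact_matrix k P \<noteq> vol *\<^sub>R mat 1"
      using eq_centroids_if_scalar[of P] P by (auto simp: X_def G_def)
    moreover have "CARD('n) \<ge> 3"
      using dim False by linarith
    ultimately show ?thesis
      using False min_eigenvalue_pair_sum_less[OF _ sym[OF P(1)] tr[OF P(1)]] by (simp add: m_def)
  qed
  have lost: "\<not> immobilizes v P" if P: "P \<in> X" "m P = 0" for P
  proof -
    obtain e :: "'n \<Rightarrow> real^'n" and d i j where e: "\<And>i j. e i \<bullet> e j = (if i = j then 1 else 0)"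
      and d: "\<And>i. contact_matrix k P *v e i = d i *\<^sub>R e i" and ij: "i \<noteq> j"
      and "min_eigenvalue_pair_sum (contact_matrix k P) = d i + d j"
      using min_eigenvalue_pair_sum_attained[OF dim sym[OF P(1)]] by blast
    then have "d i + d j = 0"
      using P(2) by (simp add: m_def)
    then show ?thesis
      using P(1) ij e d unfolding X_def
      by (intro not_immobilizes_if_eigenvalue_pair_vanishes[of P "e i" "e j" "d i" "d j"]) auto
  qed
  show ?thesis
  proof (intro conjI)
    show "affine X" "aff_dim X = int (CARD('n) * (CARD('n) + 1) div 2) - 1"
      using affine_and_aff_dim_symmetric_tuples by (auto simp: X_def)
    show "G \<in> X"
      unfolding G_def X_def by (rule centroids_in_symmetric_tuples)
    show "m G = 2 * vol" by (rule mG)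
    show "\<forall>N. openin (top_of_set X) N \<and> G \<in> N \<and> (\<forall>P\<in>N. immobilizes v P) \<longrightarrow>
       (\<forall>P\<in>N. P \<noteq> G \<longrightarrow> (if CARD('n) = 2 then m P = 2 * vol else m P < 2 * vol))"
      using decrease openin_imp_subset by blast
    show "\<forall>P\<in>X. P \<noteq> G \<and> (\<forall>i. P $ i \<in> rel_interior (face v i)) \<and> m P = 0 \<longrightarrow> \<not> immobilizes v P"
      using lost by blast
  qed
qed

end
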